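(* There exists a constant $C>0$ depending only on $p$ such that the following holds. Let $E\in\Omega_h$. Then, for any $v,w,z\in V_h(E)$, setting $e=w-z$, $$|a_E(w,v)-a_E(z,v)|\le C\left(\|w\|_{L^{p'}(E)}^{p'}+\|z\|_{L^{p'}(E)}^{p'}\right)^{\frac{p'-\underline{p}'}{p'}}\|e\|_{L^{p'}(E)}^{\underline{p}'-1}\,\|v\|_{L^{p'}(E)}$$ and $$|s_E(w,v)-s_E(z,v)|\le C\,\big[s_E(w,w)+s_E(z,z)\big]^{\frac{p'-\underline{p}'}{p'}}\,\big[s_E(e,e)\big]^{\frac{\underline{p}'-1}{p'}}\,\big[s_E(v,v)\big]^{\frac1{p'}},$$ where $\underline{p}'=\min\{p',2\}$.
   Context: Setting. $p\in(1,\infty)$ and the integer $k\ge0$ are fixed; $p'=p/(p-1)$. $\Omega_h$ is a decomposition of an open, bounded, connected polygonal domain $\Omega\subset\mathbb R^2$ with Lipschitz boundary into nonoverlapping polygonal elements $E$; $h_E$, $|E|$, $x_E$, $\mathcal E_E$ are the diameter, area, barycenter and set of edges of $E$; $h_e$, $x_e$, $n_e$ are the length, midpoint and a fixed unit normal of an edge $e$. Mesh regularity: there is $\rho>0$ (uniform over the mesh family) such that every $E$ is star-shaped with respect to a disk of radius $\ge\rho h_E$ and $h_e\ge\rho h_E$ for all $e\in\mathcal E_E$. $\mathcal P^\ell(Y)$: polynomials of total degree $\le\ell$ on $Y$ ($\mathcal P^{-1}=\{0\}$). $\operatorname{rot}w=\partial_1w_2-\partial_2w_1$; $(a_1,a_2)^\perp=(-a_2,a_1)$.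 $H(\mathrm{div};E)$ and $H(\mathrm{rot};E)$ are the spaces of vector fields in $L^2(E)^2$ whose divergence, respectively rot, lies in $L^2(E)$. Local space. $V_h(E)=\{v\in H(\mathrm{div};E)\cap H(\mathrm{rot};E): v\cdot n_e\in\mathcal P^k(e)\ \forall e\in\mathcal E_E,\ \nabla\cdot v\in\mathcal P^k(E),\ \operatorname{rot}v\in\mathcal P^{k-1}(E)\}$. $\mathrm{dof}_E(v)\in\mathbb R^{N_E}$, $N_E=\dim V_h(E)$, is the vector of degrees of freedom: (i) $\frac1{h_e}\int_e (v\cdot n_e)m$ for each $e\in\mathcal E_E$, $m=((x-x_e)/h_e)^\alpha$, $0\le\alpha\le k$ ($x$ a length coordinate on $e$); (ii) $\frac{h_E}{|E|}\int_E v\cdot\nabla m$, $m=((x-x_E)/h_E)^{\alpha}$, $1\le|\alpha|\le k$; (iii) $\frac1{|E|}\int_E v\cdot\left(\frac{x-x_E}{h_E}\right)^\perp m$, $m=((x-x_E)/h_E)^{\alpha}$, $|\alpha|\le k-1$. Forms. $a_E(w,v)=\int_E|w|^{p'-2}w\cdot v$ and $s_E(w,v)=h_E^2\,|\mathrm{dof}_E(w)|^{p'-2}\,\mathrm{dof}_E(w)\cdot\mathrm{dof}_E(v)$, where $|\cdot|$ is the Euclidean norm and $|A|^{p'-2}A$ is understood as $0$ for $A=0$. *)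

theory Defs
  imports "HOL-Analysis.Analysis" "HOL-Computational_Algebra.Polynomial"
begin

type_synonym point = "real^2"

definition perp :: "point \<Rightarrow> point" where
  "perp a = vector [- (a $ 2), a $ 1]"

section \<open>Test functions, weak divergence and rot\<close>

definition partial :: "2 \<Rightarrow> (point \<Rightarrow> real) \<Rightarrow> point \<Rightarrow> real" where
  "partial i f x = frechet_derivative f (at x) (axis i 1)"

definition grad :: "(point \<Rightarrow> real) \<Rightarrow> point \<Rightarrow> point" where
  "grad f x = (\<chi> i. partial i f x)"

primrec C_k :: "nat \<Rightarrow> (point \<Rightarrow> real) \<Rightarrow> bool" where
  "C_k 0 f \<longleftrightarrow> continuous_on UNIV f"
| "C_k (Suc m) f \<longleftrightarrow> (\<forall>x. f differentiable (at x)) \<and> (\<forall>i. C_k m (partial i f))"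

definition supp :: "(point \<Rightarrow> real) \<Rightarrow> point set" where
  "supp f = closure {x. f x \<noteq> 0}"

definition smooth_cpt :: "(point \<Rightarrow> real) \<Rightarrow> bool" where
  "smooth_cpt f \<longleftrightarrow> (\<forall>m. C_k m f) \<and> compact (supp f)"

definition L2_on :: "point set \<Rightarrow> (point \<Rightarrow> 'b::euclidean_space) \<Rightarrow> bool" where
  "L2_on E f \<longleftrightarrow> f \<in> borel_measurable (lebesgue_on E) \<and>
     integrable (lebesgue_on E) (\<lambda>x. (norm (f x))\<^sup>2)"

definition weak_div :: "point set \<Rightarrow> (point \<Rightarrow> point) \<Rightarrow> (point \<Rightarrow> real) \<Rightarrow> bool" where
  "weak_div E v d \<longleftrightarrow> (\<forall>\<phi>. smooth_cpt \<phi> \<and> supp \<phi> \<subseteq> E \<longrightarrow>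
     (LINT x|lebesgue_on E. d x * \<phi> x) = - (LINT x|lebesgue_on E. v x \<bullet> grad \<phi> x))"

definition weak_rot :: "point set \<Rightarrow> (point \<Rightarrow> point) \<Rightarrow> (point \<Rightarrow> real) \<Rightarrow> bool" where
  "weak_rot E v r \<longleftrightarrow> (\<forall>\<phi>. smooth_cpt \<phi> \<and> supp \<phi> \<subseteq> E \<longrightarrow>
     (LINT x|lebesgue_on E. r x * \<phi> x) =
     - (LINT x|lebesgue_on E. v x $ 2 * partial 1 \<phi> x - v x $ 1 * partial 2 \<phi> x))"

definition H_div :: "point set \<Rightarrow> (point \<Rightarrow> point) set" where
  "H_div E = {v. L2_on E v \<and> (\<exists>d. L2_on E d \<and> weak_div E v d)}"

definition H_rot :: "point set \<Rightarrow> (point \<Rightarrow> point) set" where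
  "H_rot E = {v. L2_on E v \<and> (\<exists>r. L2_on E r \<and> weak_rot E v r)}"

section \<open>Polygons and meshes\<close>

text \<open>A polygon is given by the cyclic list of its vertices. An angle equal to pi is allowed at
  a vertex, so that hanging nodes may be treated as vertices.\<close>

type_synonym polygon = "point list"

definition vtx :: "polygon \<Rightarrow> nat \<Rightarrow> point" where
  "vtx P i = P ! (i mod length P)"

definition edge :: "polygon \<Rightarrow> nat \<Rightarrow> point set" where
  "edge P i = closed_segment (vtx P i) (vtx P (Suc i))"

definition simple_polygon :: "polygon \<Rightarrow> bool" where
  "simple_polygon P \<longleftrightarrow> length P \<ge> 3 \<and> distinct P \<and>
     (\<forall>i<length P. \<forall>j<length P. i \<noteq> j \<longrightarrow>
        edge P i \<inter> edge P j = {vtx P i, vtx P (Suc i)} \<inter> {vtx P j, vtx P (Suc j)})"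

text \<open>The open region bounded by the polygon.\<close>

definition region :: "polygon \<Rightarrow> point set" where
  "region P = inside (\<Union>i<length P. edge P i)"

definition lipschitz_boundary :: "point set \<Rightarrow> bool" where
  "lipschitz_boundary D \<longleftrightarrow> (\<forall>x\<in>frontier D. \<exists>u \<epsilon> \<delta> L \<gamma>.
     norm u = 1 \<and> \<epsilon> > 0 \<and> \<delta> > 0 \<and> L-lipschitz_on UNIV (\<gamma> :: real \<Rightarrow> real) \<and>
     (\<forall>s t. \<bar>s\<bar> < \<epsilon> \<and> \<bar>t\<bar> < \<delta> \<longrightarrow> (x + s *\<^sub>R perp u + t *\<^sub>R u \<in> D \<longleftrightarrow> \<gamma> s < t)))"

definition polygonal_domain :: "point set \<Rightarrow> bool" where
  "polygonal_domain D \<longleftrightarrow> open D \<and> bounded D \<and> connected D \<and> D \<noteq> {} \<and>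
     (\<exists>S. finite S \<and> frontier D = (\<Union>(a, b)\<in>S. closed_segment a b)) \<and> lipschitz_boundary D"

definition decomposition :: "point set \<Rightarrow> polygon set \<Rightarrow> bool" where
  "decomposition D T \<longleftrightarrow> finite T \<and> (\<forall>P\<in>T. simple_polygon P) \<and>
     (\<forall>P\<in>T. \<forall>Q\<in>T. P \<noteq> Q \<longrightarrow> region P \<inter> region Q = {}) \<and>
     closure D = (\<Union>P\<in>T. closure (region P))"

definition star_shaped_wrt :: "point set \<Rightarrow> point set \<Rightarrow> bool" where
  "star_shaped_wrt E B \<longleftrightarrow> (\<forall>y\<in>B. \<forall>x\<in>E. closed_segment y x \<subseteq> E)"

definition edge_length :: "polygon \<Rightarrow> nat \<Rightarrow> real" where
  "edge_length P i = dist (vtx P i) (vtx P (Suc i))"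

definition diam :: "polygon \<Rightarrow> real" where
  "diam P = diameter (region P)"

definition area :: "polygon \<Rightarrow> real" where
  "area P = measure lebesgue (region P)"

definition barycenter :: "polygon \<Rightarrow> point" where
  "barycenter P = (1 / area P) *\<^sub>R (LINT x|lebesgue_on (region P). x)"

definition mesh_regular :: "real \<Rightarrow> polygon set \<Rightarrow> bool" where
  "mesh_regular \<rho> T \<longleftrightarrow> (\<forall>P\<in>T.
     (\<exists>c r. r \<ge> \<rho> * diam P \<and> ball c r \<subseteq> region P \<and> star_shaped_wrt (region P) (ball c r)) \<and>
     (\<forall>i<length P. edge_length P i \<ge> \<rho> * diam P))"

text \<open>The normal is attached to the edge as a point set, so two elements sharing an edge use the
  same normal.\<close>

definition unit_normals :: "polygon set \<Rightarrow> (point set \<Rightarrow> point) \<Rightarrow> bool" where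
  "unit_normals T n \<longleftrightarrow> (\<forall>P\<in>T. \<forall>i<length P.
     norm (n (edge P i)) = 1 \<and> n (edge P i) \<bullet> (vtx P (Suc i) - vtx P i) = 0)"

section \<open>Polynomials and normal traces\<close>

text \<open>The integer degree bound gives the zero space for the bound -1.\<close>

definition poly_space :: "int \<Rightarrow> (point \<Rightarrow> real) set" where
  "poly_space l = {q. \<exists>c :: nat \<times> nat \<Rightarrow> real. \<forall>x.
     q x = (\<Sum>(i, j) \<in> {(i, j). int i + int j \<le> l}. c (i, j) * (x $ 1) ^ i * (x $ 2) ^ j)}"

text \<open>Point of the line through an edge with length coordinate \<open>s\<close> (zero at the midpoint,
  oriented by the fixed normal). A polynomial on the edge is a \<open>real poly\<close> in \<open>s\<close>.\<close>

definition edge_point :: "(point set \<Rightarrow> point) \<Rightarrow> polygon \<Rightarrow> nat \<Rightarrow> real \<Rightarrow> point" where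
  "edge_point n P i s = midpoint (vtx P i) (vtx P (Suc i)) + s *\<^sub>R perp (n (edge P i))"

definition edge_integral :: "polygon \<Rightarrow> nat \<Rightarrow> (real \<Rightarrow> real) \<Rightarrow> real" where
  "edge_integral P i f = integral {- (edge_length P i / 2) .. edge_length P i / 2} f"

text \<open>Product of the fixed normal with the outward unit normal of the element.\<close>

definition outward_sign :: "(point set \<Rightarrow> point) \<Rightarrow> polygon \<Rightarrow> nat \<Rightarrow> real" where
  "outward_sign n P i =
     (if \<exists>\<delta>>0. \<forall>t. 0 < t \<and> t < \<delta> \<longrightarrow>
           midpoint (vtx P i) (vtx P (Suc i)) + t *\<^sub>R n (edge P i) \<notin> region P
      then 1 else - 1)"

text \<open>For \<open>v\<close> in \<open>H(div)\<close> the normal component is defined by Green's formula; its restriction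
  to an edge is obtained by testing with functions whose support meets the boundary only in the
  relative interior of that edge. The weak divergence \<open>d\<close> is unique up to null sets, so the
  quantifier over \<open>d\<close> only names it.\<close>

definition normal_trace ::
  "(point set \<Rightarrow> point) \<Rightarrow> polygon \<Rightarrow> nat \<Rightarrow> (point \<Rightarrow> point) \<Rightarrow> real poly \<Rightarrow> bool" where
  "normal_trace n P i v g \<longleftrightarrow> (\<forall>d \<phi>.
     L2_on (region P) d \<and> weak_div (region P) v d \<and> smooth_cpt \<phi> \<and>
     supp \<phi> \<inter> frontier (region P) \<subseteq> open_segment (vtx P i) (vtx P (Suc i)) \<longrightarrow>
     (LINT x|lebesgue_on (region P). v x \<bullet> grad \<phi> x + d x * \<phi> x) =
     outward_sign n P i * edge_integral P i (\<lambda>s. poly g s * \<phi> (edge_point n P i s)))"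

section \<open>Local space and degrees of freedom\<close>

definition V_h :: "nat \<Rightarrow> (point set \<Rightarrow> point) \<Rightarrow> polygon \<Rightarrow> (point \<Rightarrow> point) set" where
  "V_h k n P = {v \<in> H_div (region P) \<inter> H_rot (region P).
     (\<forall>i<length P. \<exists>g. degree g \<le> k \<and> normal_trace n P i v g) \<and>
     (\<exists>q\<in>poly_space (int k). weak_div (region P) v q) \<and>
     (\<exists>q\<in>poly_space (int k - 1). weak_rot (region P) v q)}"

definition normal_component ::
  "(point set \<Rightarrow> point) \<Rightarrow> polygon \<Rightarrow> nat \<Rightarrow> (point \<Rightarrow> point) \<Rightarrow> real poly" where
  "normal_component n P i v = (THE g. normal_trace n P i v g)"

definition scaled_monomial :: "polygon \<Rightarrow> nat \<Rightarrow> nat \<Rightarrow> point \<Rightarrow> real" where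
  "scaled_monomial P a b x =
     ((x $ 1 - barycenter P $ 1) / diam P) ^ a * ((x $ 2 - barycenter P $ 2) / diam P) ^ b"

datatype dof_index = Edge_Moment nat nat | Grad_Moment nat nat | Perp_Moment nat nat

definition dof_indices :: "nat \<Rightarrow> polygon \<Rightarrow> dof_index set" where
  "dof_indices k P =
     {Edge_Moment i a | i a. i < length P \<and> a \<le> k} \<union>
     {Grad_Moment a b | a b. 1 \<le> a + b \<and> a + b \<le> k} \<union>
     {Perp_Moment a b | a b. int a + int b \<le> int k - 1}"

fun dof :: "(point set \<Rightarrow> point) \<Rightarrow> polygon \<Rightarrow> (point \<Rightarrow> point) \<Rightarrow> dof_index \<Rightarrow> real" where
  "dof n P v (Edge_Moment i a) =
     1 / edge_length P i *
     edge_integral P i (\<lambda>s. poly (normal_component n P i v) s * (s / edge_length P i) ^ a)"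
| "dof n P v (Grad_Moment a b) =
     diam P / area P *
     (LINT x|lebesgue_on (region P). v x \<bullet> grad (scaled_monomial P a b) x)"
| "dof n P v (Perp_Moment a b) =
     1 / area P *
     (LINT x|lebesgue_on (region P).
        (v x \<bullet> perp ((1 / diam P) *\<^sub>R (x - barycenter P))) * scaled_monomial P a b x)"

section \<open>Forms and norms\<close>

text \<open>\<open>0 powr r = 0\<close> for every \<open>r\<close>, so the terms with base zero below vanish, as they should.\<close>

definition a_form :: "real \<Rightarrow> polygon \<Rightarrow> (point \<Rightarrow> point) \<Rightarrow> (point \<Rightarrow> point) \<Rightarrow> real" where
  "a_form q P w v = (LINT x|lebesgue_on (region P). norm (w x) powr (q - 2) * (w x \<bullet> v x))"

definition s_form :: "real \<Rightarrow> nat \<Rightarrow> (point set \<Rightarrow> point) \<Rightarrow> polygon \<Rightarrow>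
    (point \<Rightarrow> point) \<Rightarrow> (point \<Rightarrow> point) \<Rightarrow> real" where
  "s_form q k n P w v = (diam P)\<^sup>2 * L2_set (dof n P w) (dof_indices k P) powr (q - 2) *
     (\<Sum>j\<in>dof_indices k P. dof n P w j * dof n P v j)"

text \<open>Power with nonnegative exponent on the extended nonnegative reals, with the zeroth power
  equal to one.\<close>

definition epowr :: "ennreal \<Rightarrow> real \<Rightarrow> ennreal" where
  "epowr x r = (if r = 0 then 1 else if x = \<infinity> then \<infinity> else ennreal (enn2real x powr r))"

text \<open>The norm takes the value infinity on fields that are not \<open>q\<close>-integrable. For large \<open>q\<close> this
  can happen in the local space on a nonconvex element.\<close>

definition L_norm :: "real \<Rightarrow> polygon \<Rightarrow> (point \<Rightarrow> point) \<Rightarrow> ennreal" where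
  "L_norm q P v = epowr (\<integral>\<^sup>+ x. ennreal (norm (v x) powr q) \<partial>lebesgue_on (region P)) (1 / q)"

end

theory Submission
  imports Defs
begin

text \<open>With \<open>r = p'\<close>, the flux \<open>a \<mapsto> |a|\<^sup>r\<^sup>-\<^sup>2 a\<close> satisfies, with a constant independent of the dimension,
  \<open>| |a|\<^sup>r\<^sup>-\<^sup>2 a - |b|\<^sup>r\<^sup>-\<^sup>2 b | \<le> C (|a|\<^sup>r + |b|\<^sup>r)\<^bsup>(r-q)/r\<^esup> |a - b|\<^bsup>q-1\<^esup>\<close>, where \<open>q = min r 2\<close>.
  Pointwise application and Hoelder's inequality with the exponents \<open>(r-q)/r\<close>, \<open>(q-1)/r\<close>, \<open>1/r\<close>,
  which add up to one, give the bound for \<open>a_form\<close>. Applied to vectors of degrees of freedom it gives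
  the bound for \<open>s_form\<close>, the factor \<open>h\<^sub>E\<^sup>2\<close> being distributed with the same exponents; this needs
  that the degrees of freedom are additive, hence that normal traces are unique.\<close>

section \<open>The pointwise flux inequality and Hoelder's inequality\<close>

text \<open>Here \<open>\<alpha> = |w|\<close>, \<open>\<beta> = |z|\<close>, \<open>\<gamma> = |w - z|\<close> and \<open>D\<close> is the norm of the flux difference. Keeping only these
  scalars serves both the pointwise Euclidean norm and \<open>L2_set\<close> over the degrees of freedom,
  which is not the norm of a type.\<close>

lemma flux_difference_bound:
  fixes r q \<alpha> \<beta> \<gamma> D :: real
  assumes r: "1 < r" and q: "q = min r 2"
    and nn: "0 \<le> \<alpha>" "0 \<le> \<beta>" "0 \<le> \<gamma>"
    and tri: "\<alpha> \<le> \<beta> + \<gamma>" "\<beta> \<le> \<alpha> + \<gamma>" "\<gamma> \<le> \<alpha> + \<beta>"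
    and D: "D \<le> \<alpha> powr (r - 2) * \<gamma> + \<bar>\<alpha> powr (r - 2) - \<beta> powr (r - 2)\<bar> * \<beta>"
           "D \<le> \<beta> powr (r - 2) * \<gamma> + \<bar>\<alpha> powr (r - 2) - \<beta> powr (r - 2)\<bar> * \<alpha>"
  shows "D \<le> (r + 4) * (\<alpha> powr r + \<beta> powr r) powr ((r - q) / r) * \<gamma> powr (q - 1)"
proof -
  \<comment> \<open>The claim is symmetric in the two fields, so only \<open>b \<le> a\<close> is
    treated. Of the two assumed bounds on \<open>D\<close>, each ordering uses the one whose first
    term carries the power of the larger norm.\<close>
  have main: "D \<le> (r + 4) * (a powr r + b powr r) powr ((r - q) / r) * \<gamma> powr (q - 1)"
    if ab: "0 \<le> b" "b \<le> a" and t: "a \<le> b + \<gamma>" "\<gamma> \<le> a + b"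
      and D: "D \<le> a powr (r - 2) * \<gamma> + \<bar>a powr (r - 2) - b powr (r - 2)\<bar> * b" for a b
  proof (cases "a = 0")
    case True
    then have "b = 0" "\<gamma> = 0" using ab t nn by auto
    then show ?thesis using True D by simp
  next
    case False
    then have a: "0 < a" using ab by auto
    \<comment> \<open>For \<open>r < 2\<close> the exponent of this sum is zero, and
      \<open>0 powr 0 = 0\<close>; positivity makes the factor equal to one.\<close>
    have pos: "0 < a powr r + b powr r" using a by (simp add: add_pos_nonneg)
    have mult1: "x powr (r - 1) = x powr (r - 2) * x" if "0 \<le> x" for x
      using that r powr_mult_base[of x "r - 2"] by (simp add: mult.commute)
    show ?thesis
    proof (cases "2 \<le> r")
      case True
      \<comment> \<open>Mean value theorem for \<open>x powr (r - 1)\<close>: since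
        \<open>2 \<le> r\<close>, the derivative is nondecreasing and is bounded by its value at
        \<open>a\<close>.\<close>
      have "a powr (r - 1) - b powr (r - 1) \<le> (r - 1) * a powr (r - 2) * (a - b)"
      proof (cases "b < a")
        case b: True
        have "\<exists>l z. b < z \<and> z < a \<and> DERIV (\<lambda>x. x powr (r - 1)) z :> l
            \<and> a powr (r - 1) - b powr (r - 1) = (a - b) * l"
        proof (rule MVT[OF b])
          show "continuous_on {b..a} (\<lambda>x. x powr (r - 1))"
            using ab r by (intro continuous_on_powr' continuous_intros) auto
          show "(\<lambda>x. x powr (r - 1)) differentiable (at x)" if "b < x" "x < a" for x
            using has_real_derivative_powr[of x "r - 1"] that ab
            by (auto simp: real_differentiable_def)
        qed
        then obtain l z where z: "b < z" "z < a" and l: "DERIV (\<lambda>x. x powr (r - 1)) z :> l"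
          and eq: "a powr (r - 1) - b powr (r - 1) = (a - b) * l" by blast
        have "l = (r - 1) * z powr (r - 2)"
          using DERIV_unique[OF l has_real_derivative_powr[of z "r - 1"]] z ab by simp
        moreover have "z powr (r - 2) \<le> a powr (r - 2)" using z ab True by (intro powr_mono2) auto
        ultimately have "(a - b) * l \<le> (a - b) * ((r - 1) * a powr (r - 2))"
          using b r by (intro mult_left_mono) auto
        then show ?thesis using eq by (simp add: mult.commute mult.left_commute)
      qed (use ab in auto)
      moreover have "\<bar>a powr (r - 2) - b powr (r - 2)\<bar> * b \<le> a powr (r - 1) - b powr (r - 1)"
      proof -
        have "b powr (r - 2) \<le> a powr (r - 2)" using ab True by (intro powr_mono2) auto
        moreover have "a powr (r - 2) * b \<le> a powr (r - 2) * a" using ab by (intro mult_left_mono) auto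
        ultimately show ?thesis using ab a by (simp add: mult1 algebra_simps)
      qed
      moreover have "(r - 1) * a powr (r - 2) * (a - b) \<le> (r - 1) * a powr (r - 2) * \<gamma>"
        using t r by (intro mult_left_mono) auto
      ultimately have "D \<le> r * a powr (r - 2) * \<gamma>" using D by (simp add: algebra_simps)
      \<comment> \<open>The constant \<open>r + 4\<close> is common to both regimes: it dominates
        \<open>r\<close> here and the factor 4 that arises for \<open>r < 2\<close>.\<close>
      also have "\<dots> \<le> (r + 4) * a powr (r - 2) * \<gamma>" using nn by (intro mult_right_mono) auto
      also have "a powr (r - 2) = (a powr r) powr ((r - 2) / r)" using r by (simp add: powr_powr)
      also have "(r + 4) * (a powr r) powr ((r - 2) / r) * \<gamma>
          \<le> (r + 4) * (a powr r + b powr r) powr ((r - 2) / r) * \<gamma>"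
        using True nn by (intro mult_right_mono mult_left_mono powr_mono2) auto
      finally show ?thesis using True nn q by simp
    next
      case False
      show ?thesis
      proof (cases "\<gamma> = 0")
        case True
        then have "a = b" using t ab by auto
        then show ?thesis using True D by simp
      next
        case g: False
        then have "0 < \<gamma>" using nn by auto
        \<comment> \<open>Since \<open>\<gamma> \<le> a + b\<close> and \<open>b \<le> a\<close>,
          half of \<open>\<gamma>\<close> is at most \<open>a\<close>, and the negative exponent
          reverses the order.\<close>
        have "a powr (r - 2) \<le> (\<gamma> / 2) powr (r - 2)"
          using False t ab \<open>0 < \<gamma>\<close> by (intro powr_mono2') auto
        also have "\<dots> = 2 powr (2 - r) * \<gamma> powr (r - 2)"
          using \<open>0 < \<gamma>\<close> by (simp add: powr_divide powr_minus_divide powr_diff)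
        also have "\<dots> \<le> 2 powr 1 * \<gamma> powr (r - 2)"
          using r by (intro mult_right_mono powr_mono) auto
        finally have 1: "a powr (r - 2) * \<gamma> \<le> 2 * \<gamma> powr (r - 1)"
          using mult_right_mono[of "a powr (r - 2)" "2 * \<gamma> powr (r - 2)" \<gamma>] nn
          by (simp add: mult1 algebra_simps)
        \<comment> \<open>For \<open>b > 0\<close> the left side is
          \<open>b powr (r - 1) - a powr (r - 2) * b\<close>. Replacing its first term by
          \<open>a powr (r - 1)\<close> leaves \<open>a powr (r - 2) * (a - b)\<close>.\<close>
        have "\<bar>a powr (r - 2) - b powr (r - 2)\<bar> * b \<le> a powr (r - 2) * \<gamma>"
        proof (cases "b = 0")
          case False
          then have b: "0 < b" using ab by auto
          have "a powr (r - 2) \<le> b powr (r - 2)"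
            using \<open>\<not> 2 \<le> r\<close> b ab by (intro powr_mono2') auto
          moreover have "b powr (r - 1) \<le> a powr (r - 1)" using ab r by (intro powr_mono2) auto
          moreover have "a powr (r - 2) * (a - b) \<le> a powr (r - 2) * \<gamma>"
            using t by (intro mult_left_mono) auto
          ultimately show ?thesis using ab a by (simp add: mult1 algebra_simps)
        qed (use nn in auto)
        then have "D \<le> 4 * \<gamma> powr (r - 1)" using D 1 by linarith
        also have "\<dots> \<le> (r + 4) * \<gamma> powr (r - 1)" using r by (intro mult_right_mono) auto
        finally show ?thesis using False q pos by simp
      qed
    qed
  qed
  show ?thesis
  proof (cases "\<beta> \<le> \<alpha>")
    case True
    show ?thesis by (rule main[OF nn(2) True tri(1,3) D(1)])
  next
    case False
    then show ?thesis using main[of \<alpha> \<beta>] nn tri D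
      by (simp add: add.commute abs_minus_commute)
  qed
qed

text \<open>With \<open>G\<close> the product on the left, \<open>ln t \<le> t - 1\<close> at
  \<open>t = u / G\<close> gives \<open>G * (1 + ln u - ln G) \<le> u\<close> for each variable
  \<open>u\<close>. The weighted mean of these bounds is the claim, because \<open>ln G\<close> is
  the weighted mean of the logarithms.\<close>

lemma weighted_am_gm3:
  fixes a b c x y z :: real
  assumes "0 \<le> a" "0 \<le> b" "0 \<le> c" "a + b + c = 1" "0 \<le> x" "0 \<le> y" "0 \<le> z"
  shows "x powr a * y powr b * z powr c \<le> a * x + b * y + c * z"
\<comment> \<open>A zero variable annihilates the product even if its exponent is zero, because
  \<open>0 powr 0 = 0\<close>.\<close>
proof (cases "x = 0 \<or> y = 0 \<or> z = 0")
  case True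
  then show ?thesis using assms by auto
next
  case False
  then have pos: "0 < x" "0 < y" "0 < z" using assms by auto
  have key: "G * (1 + ln u - ln G) \<le> u" if "0 < u" "0 < G" for u G :: real
  proof -
    have "ln (u / G) \<le> u / G - 1" using that by (intro ln_le_minus_one) auto
    then have "G * (1 + ln (u / G)) \<le> G * (u / G)" using that by (intro mult_left_mono) auto
    then show ?thesis using that by (simp add: ln_div algebra_simps)
  qed
  define G where "G = x powr a * y powr b * z powr c"
  have G: "0 < G" using pos by (simp add: G_def)
  have lnG: "ln G = a * ln x + b * ln y + c * ln z"
    using pos by (simp add: G_def ln_mult ln_powr)
  have "a * (G * (1 + ln x - ln G)) + b * (G * (1 + ln y - ln G)) + c * (G * (1 + ln z - ln G))
     \<le> a * x + b * y + c * z"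
    using assms pos G by (intro add_mono mult_left_mono key) auto
  moreover have "a * (G * (1 + ln x - ln G)) + b * (G * (1 + ln y - ln G)) + c * (G * (1 + ln z - ln G))
     = G * ((a + b + c) + (a * ln x + b * ln y + c * ln z) - (a + b + c) * ln G)"
    by (simp add: algebra_simps)
  ultimately show ?thesis using lnG assms(4) by (simp add: G_def)
qed

text \<open>After division by their integrals, the three functions are compared pointwise by the
  weighted AM-GM inequality. The resulting integrable majorant has integral \<open>K\<close>, which
  yields integrability and the bound together.\<close>

lemma Holder3:
  fixes F G H :: "'a \<Rightarrow> real"
  assumes abc: "0 \<le> a" "0 \<le> b" "0 \<le> c" "a + b + c = 1"
    and int: "integrable M F" "integrable M G" "integrable M H"
    and nn: "\<And>x. 0 \<le> F x" "\<And>x. 0 \<le> G x" "\<And>x. 0 \<le> H x"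
    and pos: "0 < integral\<^sup>L M F" "0 < integral\<^sup>L M G" "0 < integral\<^sup>L M H"
  shows "integrable M (\<lambda>x. F x powr a * G x powr b * H x powr c)"
    and "(LINT x|M. F x powr a * G x powr b * H x powr c)
      \<le> integral\<^sup>L M F powr a * integral\<^sup>L M G powr b * integral\<^sup>L M H powr c"
proof -
  define f g h where "f = integral\<^sup>L M F" and "g = integral\<^sup>L M G" and "h = integral\<^sup>L M H"
  have fgh: "0 < f" "0 < g" "0 < h" using pos by (auto simp: f_def g_def h_def)
  define K where "K = f powr a * g powr b * h powr c"
  have K: "0 < K" using fgh by (simp add: K_def)
  have bound: "F x powr a * G x powr b * H x powr c
      \<le> K * (a * (F x / f) + b * (G x / g) + c * (H x / h))" for x
  proof -
    have "(F x / f) powr a * (G x / g) powr b * (H x / h) powr c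
      \<le> a * (F x / f) + b * (G x / g) + c * (H x / h)"
      using abc nn fgh by (intro weighted_am_gm3) (auto simp: less_imp_le)
    then have "K * ((F x / f) powr a * (G x / g) powr b * (H x / h) powr c)
      \<le> K * (a * (F x / f) + b * (G x / g) + c * (H x / h))"
      using K by (intro mult_left_mono) auto
    moreover have "K * ((F x / f) powr a * (G x / g) powr b * (H x / h) powr c)
      = F x powr a * G x powr b * H x powr c"
      using nn fgh by (simp add: K_def powr_divide less_imp_le)
    ultimately show ?thesis by simp
  qed
  have iR: "integrable M (\<lambda>x. K * (a * (F x / f) + b * (G x / g) + c * (H x / h)))"
    using int by auto
  have [measurable]: "F \<in> borel_measurable M" "G \<in> borel_measurable M" "H \<in> borel_measurable M"
    using int by auto
  show iL: "integrable M (\<lambda>x. F x powr a * G x powr b * H x powr c)"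
    by (rule Bochner_Integration.integrable_bound[OF iR])
      (auto intro!: AE_I2 order_trans[OF bound] abs_ge_self)
  have "(LINT x|M. F x powr a * G x powr b * H x powr c)
      \<le> (LINT x|M. K * (a * (F x / f) + b * (G x / g) + c * (H x / h)))"
    by (rule integral_mono[OF iL iR bound])
  also have "\<dots> = K * (a * (f / f) + b * (g / g) + c * (h / h))"
    using int by (simp add: f_def g_def h_def)
  also have "\<dots> = K" using fgh abc by simp
  finally show "(LINT x|M. F x powr a * G x powr b * H x powr c)
      \<le> integral\<^sup>L M F powr a * integral\<^sup>L M G powr b * integral\<^sup>L M H powr c"
    by (simp add: K_def f_def g_def h_def)
qed

section \<open>Smooth bump functions\<close>

text \<open>The functions \<open>flat n\<close> span a space closed under differentiation, so the expressions built
  from them and the coordinates are closed under partial derivatives; this gives \<open>C_k\<close> for all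
  orders at once, without computing higher derivatives.\<close>

definition flat :: "nat \<Rightarrow> real \<Rightarrow> real" where
  "flat n t = (if t \<le> 0 then 0 else exp (- (1 / t)) * (1 / t) ^ n)"

text \<open>From the right, the substitution \<open>u = 1 / t\<close> reduces the claim to the decay
  of \<open>u ^ n / exp u\<close> at infinity; from the left the function is zero.\<close>

lemma flat_tendsto_0: "(flat n \<longlongrightarrow> 0) (at 0)"
proof -
  have "((\<lambda>t. inverse t ^ n / exp (inverse t)) \<longlongrightarrow> (0::real)) (at_right 0)"
    by (rule filterlim_compose[OF tendsto_power_div_exp_0 filterlim_inverse_at_top_right])
  then have "(flat n \<longlongrightarrow> 0) (at_right 0)"
    by (rule Lim_transform_eventually)
      (auto simp: flat_def eventually_at_right_field exp_minus field_simps intro!: exI[of _ 1])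
  moreover have "(flat n \<longlongrightarrow> 0) (at_left 0)"
    by (rule Lim_transform_eventually[OF tendsto_const[of 0]])
      (auto simp: flat_def eventually_at_left_field intro!: exI[of _ "-1"])
  ultimately show ?thesis by (simp add: filterlim_split_at)
qed

text \<open>Away from 0 this is ordinary calculus. At 0 the difference quotient of
  \<open>flat n\<close> is \<open>flat (Suc n)\<close>, which tends to 0, the value of the formula
  there.\<close>

lemma DERIV_flat:
  "(flat n has_real_derivative flat (n + 2) t - real n * flat (n + 1) t) (at t)"
proof (cases t "0 :: real" rule: linorder_cases)
  case less
  have "((\<lambda>_. 0) has_real_derivative 0) (at t)" by simp
  then have "(flat n has_real_derivative 0) (at t)"
    by (rule has_field_derivative_transform_within_open[of _ _ _ "{..<0}"])
      (use less in \<open>auto simp: flat_def\<close>)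
  then show ?thesis using less by (simp add: flat_def)
next
  case equal
  have "((\<lambda>h. (flat n (0 + h) - flat n 0) / h) \<longlongrightarrow> 0) (at 0)"
    by (rule Lim_transform_eventually[OF flat_tendsto_0[of "Suc n"]])
      (auto simp: flat_def eventually_at_filter field_simps)
  then show ?thesis using equal by (simp add: DERIV_def flat_def)
next
  case greater
  have recip: "((\<lambda>t. 1 / t) has_real_derivative - ((1 / t)\<^sup>2)) (at t)"
    using greater by (auto intro!: derivative_eq_intros simp: power2_eq_square field_simps)
  \<comment> \<open>The case split on \<open>n\<close> handles the truncated subtraction in
    \<open>u ^ (n - Suc 0)\<close>, the form produced by the power rule.\<close>
  have "e * - (- (u\<^sup>2)) * u ^ n + (real n * (- (u\<^sup>2) * u ^ (n - Suc 0))) * e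
      = e * u ^ (n + 2) - real n * (e * u ^ (n + 1))" for e u :: real
    by (cases n) (simp_all add: power2_eq_square algebra_simps)
  from DERIV_cong[OF DERIV_mult[OF DERIV_fun_exp[OF DERIV_minus[OF recip]] DERIV_power[OF recip]] this]
  have "((\<lambda>t. exp (- (1 / t)) * (1 / t) ^ n) has_real_derivative
      exp (- (1 / t)) * (1 / t) ^ (n + 2) - real n * (exp (- (1 / t)) * (1 / t) ^ (n + 1))) (at t)" .
  then have "(flat n has_real_derivative
      exp (- (1 / t)) * (1 / t) ^ (n + 2) - real n * (exp (- (1 / t)) * (1 / t) ^ (n + 1))) (at t)"
    by (rule has_field_derivative_transform_within_open[of _ _ _ "{0<..}"])
      (use greater in \<open>auto simp: flat_def\<close>)
  then show ?thesis using greater by (simp add: flat_def)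
qed

section \<open>Expressions closed under partial derivatives\<close>

inductive smooth_expr :: "(point \<Rightarrow> real) \<Rightarrow> bool" where
  const: "smooth_expr (\<lambda>_. c)"
| coord: "smooth_expr (\<lambda>x. x $ i)"
| add: "smooth_expr f \<Longrightarrow> smooth_expr g \<Longrightarrow> smooth_expr (\<lambda>x. f x + g x)"
| mult: "smooth_expr f \<Longrightarrow> smooth_expr g \<Longrightarrow> smooth_expr (\<lambda>x. f x * g x)"
| flat: "smooth_expr f \<Longrightarrow> smooth_expr (\<lambda>x. flat n (f x))"

lemma smooth_expr_diff:
  assumes "smooth_expr f" "smooth_expr g" shows "smooth_expr (\<lambda>x. f x - g x)"
  using smooth_expr.add[OF assms(1) smooth_expr.mult[OF smooth_expr.const[of "-1"] assms(2)]]
  by simp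

lemma smooth_expr_power: "smooth_expr f \<Longrightarrow> smooth_expr (\<lambda>x. f x ^ n)"
  by (induction n) (auto intro: smooth_expr.intros)

text \<open>The induction carries the partial derivatives along as expressions. Differentiability
  and the fact that \<open>partial i f\<close> is again an expression can then both be read
  off.\<close>

lemma smooth_expr_has_derivative:
  assumes "smooth_expr f"
  shows "\<exists>g. (\<forall>i. smooth_expr (g i)) \<and>
    (\<forall>x. (f has_derivative (\<lambda>h. \<Sum>i\<in>UNIV. g i x * h $ i)) (at x))"
  using assms
proof induction
  case (const c)
  show ?case by (rule exI[of _ "\<lambda>i x. 0"]) (auto intro: smooth_expr.intros)
next
  case (coord j)
  have "(\<lambda>h::point. \<Sum>i\<in>UNIV. (if i = j then 1 else 0) * h $ i) = (\<lambda>h. h $ j)"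
    by (simp add: if_distrib[of "\<lambda>t. t * _"] cong: if_cong)
  moreover have "((\<lambda>x::point. x $ j) has_derivative (\<lambda>h. h $ j)) (at x)" for x
    by (rule bounded_linear_imp_has_derivative[OF bounded_linear_vec_nth])
  ultimately show ?case
    by (intro exI[of _ "\<lambda>i x. if i = j then 1 else 0"]) (auto intro: smooth_expr.intros)
next
  case (add f g)
  then obtain f' g' where "\<And>i. smooth_expr (f' i)" "\<And>i. smooth_expr (g' i)"
    and "\<And>x. (f has_derivative (\<lambda>h. \<Sum>i\<in>UNIV. f' i x * h $ i)) (at x)"
    and "\<And>x. (g has_derivative (\<lambda>h. \<Sum>i\<in>UNIV. g' i x * h $ i)) (at x)" by blast
  then show ?case
    by (intro exI[of _ "\<lambda>i x. f' i x + g' i x"])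
      (auto intro!: smooth_expr.intros derivative_eq_intros simp: sum.distrib algebra_simps)
next
  case (mult f g)
  then obtain f' g' where "\<And>i. smooth_expr (f' i)" "\<And>i. smooth_expr (g' i)"
    and "\<And>x. (f has_derivative (\<lambda>h. \<Sum>i\<in>UNIV. f' i x * h $ i)) (at x)"
    and "\<And>x. (g has_derivative (\<lambda>h. \<Sum>i\<in>UNIV. g' i x * h $ i)) (at x)" by blast
  with mult show ?case
    by (intro exI[of _ "\<lambda>i x. f x * g' i x + f' i x * g x"])
      (auto intro!: smooth_expr.intros derivative_eq_intros
        simp: sum.distrib sum_distrib_left sum_distrib_right algebra_simps)
next
  case (flat f n)
  then obtain f' where 1: "\<And>i. smooth_expr (f' i)"
    and 2: "\<And>x. (f has_derivative (\<lambda>h. \<Sum>i\<in>UNIV. f' i x * h $ i)) (at x)" by blast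
  have "((\<lambda>x. flat n (f x)) has_derivative
      (\<lambda>h. \<Sum>i\<in>UNIV. (flat (n + 2) (f x) - real n * flat (n + 1) (f x)) * f' i x * h $ i)) (at x)" for x
    using has_derivative_compose[OF 2 DERIV_flat[unfolded has_field_derivative_def]]
    by (simp add: sum_distrib_left mult.assoc)
  moreover have "smooth_expr (\<lambda>x. (flat (n + 2) (f x) - real n * flat (n + 1) (f x)) * f' i x)" for i
    by (intro smooth_expr_diff smooth_expr.intros flat.hyps 1)
  ultimately show ?case
    by (intro exI[of _ "\<lambda>i x. (flat (n + 2) (f x) - real n * flat (n + 1) (f x)) * f' i x"]) blast
qed

lemma smooth_expr_differentiable: "smooth_expr f \<Longrightarrow> f differentiable (at x)"
  using smooth_expr_has_derivative[of f] by (auto simp: differentiable_def)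

lemma smooth_expr_partial:
  assumes "smooth_expr f" shows "smooth_expr (partial i f)"
proof -
  obtain g where g: "\<And>i. smooth_expr (g i)"
    and f: "\<And>x. (f has_derivative (\<lambda>h. \<Sum>i\<in>UNIV. g i x * h $ i)) (at x)"
    using smooth_expr_has_derivative[OF assms] by blast
  have "partial i f = g i"
    by (rule ext) (simp add: partial_def frechet_derivative_at[OF f, symmetric] axis_def
        if_distrib[of "\<lambda>t. _ * t"] cong: if_cong)
  then show ?thesis using g by simp
qed

lemma differentiable_imp_continuous_UNIV:
  "(\<And>x. f differentiable (at x)) \<Longrightarrow> continuous_on UNIV f"
  by (auto intro!: continuous_at_imp_continuous_on differentiable_imp_continuous_within)

lemma smooth_expr_continuous: "smooth_expr f \<Longrightarrow> continuous_on UNIV f"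
  by (intro differentiable_imp_continuous_UNIV smooth_expr_differentiable)

lemma smooth_expr_C_k: "smooth_expr f \<Longrightarrow> C_k m f"
  by (induction m arbitrary: f)
    (auto intro: smooth_expr_continuous smooth_expr_differentiable smooth_expr_partial)

text \<open>The witness applies \<open>flat 0\<close> to the squared radius minus the squared
  distance to \<open>c\<close>. The squared distance, unlike the distance, is a polynomial in the
  coordinates, so the witness is a \<open>smooth_expr\<close>.\<close>

lemma smooth_bump:
  fixes c :: point and r :: real
  assumes "0 < r"
  obtains \<phi> where "smooth_cpt \<phi>" "supp \<phi> \<subseteq> cball c r" "\<And>x. 0 \<le> \<phi> x" "\<phi> c \<noteq> 0"
proof
  define \<phi> where "\<phi> x = flat 0 (r\<^sup>2 - ((x $ 1 - c $ 1)\<^sup>2 + (x $ 2 - c $ 2)\<^sup>2))" for x :: point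
  have smooth: "smooth_expr \<phi>"
    unfolding \<phi>_def
    by (intro smooth_expr.flat smooth_expr_diff smooth_expr.add smooth_expr_power
        smooth_expr.const smooth_expr.coord)
  have zero: "\<phi> x = 0" if "x \<notin> cball c r" for x
  proof -
    have "r \<le> dist c x" using that by simp
    then have "r\<^sup>2 \<le> (dist c x)\<^sup>2" using assms by (intro power_mono) auto
    also have "\<dots> = (x $ 1 - c $ 1)\<^sup>2 + (x $ 2 - c $ 2)\<^sup>2"
      by (simp add: dist_norm norm_vec_def L2_set_def sum_2 power2_commute)
    finally show ?thesis by (simp add: \<phi>_def flat_def)
  qed
  show supp: "supp \<phi> \<subseteq> cball c r"
    unfolding supp_def using zero by (intro closure_minimal subsetI closed_cball) blast
  then have "compact (supp \<phi>)"
    using bounded_subset[OF bounded_cball] by (auto simp: supp_def compact_eq_bounded_closed)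
  then show "smooth_cpt \<phi>" by (simp add: smooth_cpt_def smooth_expr_C_k[OF smooth])
  show "0 \<le> \<phi> x" for x by (simp add: \<phi>_def flat_def)
  show "\<phi> c \<noteq> 0" using assms by (simp add: \<phi>_def flat_def)
qed

lemma smooth_cpt_continuous:
  assumes "smooth_cpt \<phi>" shows "continuous_on UNIV \<phi>" "continuous_on UNIV (grad \<phi>)"
proof -
  have C1: "C_k (Suc 0) \<phi>" using assms by (simp only: smooth_cpt_def)
  then show "continuous_on UNIV \<phi>" by (auto intro: differentiable_imp_continuous_UNIV)
  have "continuous_on UNIV (partial i \<phi>)" for i using C1 by simp
  then show "continuous_on UNIV (grad \<phi>)"
    unfolding grad_def by (intro continuous_on_vec_lambda)
qed

section \<open>Normal traces and additivity of the degrees of freedom\<close>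

text \<open>A continuous \<open>g\<close> is bounded on the compact closure of \<open>E\<close>, and
  \<open>t \<le> 1 + t^2\<close> dominates the norm of \<open>f\<close> by an integrable function on
  a set of finite measure. This is what allows the integrals in Green's formula and in the moments
  to be split linearly.\<close>

lemma integrable_L2_inner:
  fixes f g :: "point \<Rightarrow> 'b::euclidean_space"
  assumes E: "open E" "bounded E" and f: "L2_on E f" and g: "continuous_on UNIV g"
  shows "integrable (lebesgue_on E) (\<lambda>x. f x \<bullet> g x)"
proof -
  have fin: "emeasure lebesgue E < \<infinity>" and [measurable]: "E \<in> sets lebesgue"
    using E bounded_set_imp_lmeasurable[of E] by (auto simp: fmeasurable_def)
  have meas: "f \<in> borel_measurable (lebesgue_on E)"
    and sq: "integrable (lebesgue_on E) (\<lambda>x. (norm (f x))\<^sup>2)"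
    using f by (auto simp: L2_on_def)
  have gm: "g \<in> borel_measurable (lebesgue_on E)"
    using E continuous_on_subset[OF g]
    by (intro continuous_imp_measurable_on_sets_lebesgue) auto
  have "compact (g ` closure E)"
    using E continuous_on_subset[OF g] by (intro compact_continuous_image) auto
  then obtain B where B: "\<And>x. x \<in> closure E \<Longrightarrow> norm (g x) \<le> B"
    using compact_imp_bounded bounded_iff by (metis imageI)
  have int: "integrable (lebesgue_on E) (\<lambda>x. B * (1 + (norm (f x))\<^sup>2))"
    using sq fin by (intro integrable_mult_right Bochner_Integration.integrable_add
        finite_measure.integrable_const finite_measureI) (auto simp: emeasure_restrict_space)
  show ?thesis
  proof (rule Bochner_Integration.integrable_bound[OF int])
    show "(\<lambda>x. f x \<bullet> g x) \<in> borel_measurable (lebesgue_on E)"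
      using meas gm by measurable
    show "AE x in lebesgue_on E. norm (f x \<bullet> g x) \<le> norm (B * (1 + (norm (f x))\<^sup>2))"
    proof (rule AE_I2)
      fix x assume "x \<in> space (lebesgue_on E)"
      then have "x \<in> closure E" using closure_subset by auto
      then have g: "norm (g x) \<le> B" by (rule B)
      have "0 \<le> (norm (f x) - 1)\<^sup>2 + (norm (f x))\<^sup>2 + 1" by simp
      then have "norm (f x) \<le> 1 + (norm (f x))\<^sup>2"
        by (simp add: power2_diff)
      then have "norm (f x) * norm (g x) \<le> (1 + (norm (f x))\<^sup>2) * B"
        using g by (intro mult_mono) auto
      moreover have "norm (f x \<bullet> g x) \<le> norm (f x) * norm (g x)"
        by (simp add: Cauchy_Schwarz_ineq2)
      ultimately show "norm (f x \<bullet> g x) \<le> norm (B * (1 + (norm (f x))\<^sup>2))"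
        by (simp add: mult.commute abs_if)
    qed
  qed
qed

section \<open>Linear operations on square-integrable fields and weak divergences\<close>

lemma L2_on_add:
  fixes f g :: "point \<Rightarrow> 'b::euclidean_space"
  assumes "L2_on E f" "L2_on E g" shows "L2_on E (\<lambda>x. f x + g x)"
proof -
  have [measurable]: "f \<in> borel_measurable (lebesgue_on E)" "g \<in> borel_measurable (lebesgue_on E)"
    using assms by (auto simp: L2_on_def)
  have "integrable (lebesgue_on E) (\<lambda>x. 2 * (norm (f x))\<^sup>2 + 2 * (norm (g x))\<^sup>2)"
    using assms by (auto simp: L2_on_def)
  then have "integrable (lebesgue_on E) (\<lambda>x. (norm (f x + g x))\<^sup>2)"
  proof (rule Bochner_Integration.integrable_bound)
    show "AE x in lebesgue_on E. norm ((norm (f x + g x))\<^sup>2)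
        \<le> norm (2 * (norm (f x))\<^sup>2 + 2 * (norm (g x))\<^sup>2)"
    proof (rule AE_I2)
      fix x
      have "(norm (f x + g x))\<^sup>2 \<le> (norm (f x) + norm (g x))\<^sup>2"
        by (intro power_mono norm_triangle_ineq) auto
      also have "\<dots> \<le> 2 * (norm (f x))\<^sup>2 + 2 * (norm (g x))\<^sup>2"
        using sum_squares_bound[of "norm (f x)" "norm (g x)"] by (simp add: power2_sum)
      finally show "norm ((norm (f x + g x))\<^sup>2) \<le> norm (2 * (norm (f x))\<^sup>2 + 2 * (norm (g x))\<^sup>2)"
        by simp
    qed
  qed measurable
  then show ?thesis by (simp add: L2_on_def)
qed

lemma L2_on_minus:
  fixes f :: "point \<Rightarrow> 'b::euclidean_space"
  shows "L2_on E f \<Longrightarrow> L2_on E (\<lambda>x. - f x)"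
  by (auto simp: L2_on_def)

lemma L2_on_diff:
  fixes f g :: "point \<Rightarrow> 'b::euclidean_space"
  assumes "L2_on E f" "L2_on E g" shows "L2_on E (\<lambda>x. f x - g x)"
  using L2_on_add[OF assms(1) L2_on_minus[OF assms(2)]] by simp

lemma weak_div_add:
  assumes E: "open E" "bounded E" and "L2_on E v" "L2_on E w" "L2_on E d" "L2_on E c"
    and div: "weak_div E v d" "weak_div E w c"
  shows "weak_div E (\<lambda>x. v x + w x) (\<lambda>x. d x + c x)"
  unfolding weak_div_def
proof (intro allI impI)
  fix \<phi> assume \<phi>: "smooth_cpt \<phi> \<and> supp \<phi> \<subseteq> E"
  then have cont: "continuous_on UNIV \<phi>" "continuous_on UNIV (grad \<phi>)"
    by (auto intro: smooth_cpt_continuous)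
  have int: "integrable (lebesgue_on E) (\<lambda>x. d x * \<phi> x)" "integrable (lebesgue_on E) (\<lambda>x. c x * \<phi> x)"
    "integrable (lebesgue_on E) (\<lambda>x. v x \<bullet> grad \<phi> x)" "integrable (lebesgue_on E) (\<lambda>x. w x \<bullet> grad \<phi> x)"
    using assms cont integrable_L2_inner[of E _ \<phi>] integrable_L2_inner[of E _ "grad \<phi>"] by auto
  show "(LINT x|lebesgue_on E. (d x + c x) * \<phi> x)
      = - (LINT x|lebesgue_on E. (v x + w x) \<bullet> grad \<phi> x)"
    using int div \<phi> by (simp add: weak_div_def inner_add_left distrib_right)
qed

lemma weak_div_minus: "weak_div E v d \<Longrightarrow> weak_div E (\<lambda>x. - v x) (\<lambda>x. - d x)"
  by (simp add: weak_div_def)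

lemma H_div_diff:
  assumes E: "open E" "bounded E" and "v \<in> H_div E" "w \<in> H_div E"
  shows "(\<lambda>x. v x - w x) \<in> H_div E"
proof -
  obtain d c where d: "L2_on E d" "weak_div E v d" and c: "L2_on E c" "weak_div E w c"
    and vw: "L2_on E v" "L2_on E w"
    using assms by (auto simp: H_div_def)
  have "weak_div E (\<lambda>x. v x + - w x) (\<lambda>x. d x + - c x)"
    by (intro weak_div_add E vw d c L2_on_minus weak_div_minus)
  then show ?thesis using L2_on_diff[OF vw] L2_on_diff[OF d(1) c(1)] by (auto simp: H_div_def)
qed

section \<open>Regions, edges and normal traces of a polygon\<close>

lemma
  shows open_region: "open (region P)" and bounded_region: "bounded (region P)"
    and frontier_region: "frontier (region P) \<subseteq> (\<Union>i<length P. edge P i)"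
proof -
  have "compact (\<Union>i<length P. edge P i)"
    by (intro compact_UN) (auto simp: edge_def)
  then have c: "closed (\<Union>i<length P. edge P i)" and "bounded (region P)"
    by (auto simp: region_def compact_imp_closed compact_imp_bounded intro: bounded_inside)
  then show "bounded (region P)" by simp
  show "open (region P)" using c by (simp add: region_def open_inside)
  show "frontier (region P) \<subseteq> (\<Union>i<length P. edge P i)"
    unfolding region_def by (rule frontier_inside_subset[OF c])
qed

lemma continuous_on_edge_point: "continuous_on S (edge_point n P i)"
  unfolding edge_point_def by (intro continuous_intros)

lemma edge_integrable:
  assumes "continuous_on UNIV \<phi>"
  shows "(\<lambda>s. poly g s * \<phi> (edge_point n P i s)) integrable_on {a..b}"
  by (intro integrable_continuous_real continuous_intros
      continuous_on_compose2[OF assms continuous_on_edge_point]) auto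

text \<open>For a weak divergence \<open>d\<close> of the difference and any weak divergence
  \<open>c\<close> of \<open>w\<close>, the sum \<open>d + c\<close> is a weak divergence of
  \<open>v\<close>. Since \<open>normal_trace\<close> quantifies over all weak divergences, Green's
  formulas for \<open>v\<close> and \<open>w\<close> apply and can be subtracted.\<close>

lemma normal_trace_diff:
  assumes v: "v \<in> H_div (region P)" and w: "w \<in> H_div (region P)"
    and g: "normal_trace n P i v g" and h: "normal_trace n P i w h"
  shows "normal_trace n P i (\<lambda>x. v x - w x) (g - h)"
  unfolding normal_trace_def
proof (intro allI impI, elim conjE)
  fix d \<phi>
  assume d: "L2_on (region P) d" "weak_div (region P) (\<lambda>x. v x - w x) d"
    and \<phi>: "smooth_cpt \<phi>"
    and supp: "supp \<phi> \<inter> frontier (region P) \<subseteq> open_segment (vtx P i) (vtx P (Suc i))"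
  obtain c where c: "L2_on (region P) c" "weak_div (region P) w c"
    using w by (auto simp: H_div_def)
  have vw: "L2_on (region P) v" "L2_on (region P) w" using v w by (auto simp: H_div_def)
  note E = open_region[of P] bounded_region[of P]
  have dc: "L2_on (region P) (\<lambda>x. d x + c x)" "weak_div (region P) v (\<lambda>x. d x + c x)"
    using L2_on_add[OF d(1) c(1)] weak_div_add[OF E L2_on_diff[OF vw] vw(2) d(1) c(1) d(2) c(2)]
    by auto
  have cont: "continuous_on UNIV \<phi>" "continuous_on UNIV (grad \<phi>)"
    using \<phi> by (auto intro: smooth_cpt_continuous)
  have int: "integrable (lebesgue_on (region P)) (\<lambda>x. d x * \<phi> x)"
    "integrable (lebesgue_on (region P)) (\<lambda>x. c x * \<phi> x)"
    "integrable (lebesgue_on (region P)) (\<lambda>x. v x \<bullet> grad \<phi> x)"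
    "integrable (lebesgue_on (region P)) (\<lambda>x. w x \<bullet> grad \<phi> x)"
    using E vw d c cont integrable_L2_inner[of "region P" _ \<phi>]
      integrable_L2_inner[of "region P" _ "grad \<phi>"] by auto
  have "(LINT x|lebesgue_on (region P). v x \<bullet> grad \<phi> x + (d x + c x) * \<phi> x)
      - (LINT x|lebesgue_on (region P). w x \<bullet> grad \<phi> x + c x * \<phi> x)
      = (LINT x|lebesgue_on (region P). (v x - w x) \<bullet> grad \<phi> x + d x * \<phi> x)"
    using int by (simp add: inner_diff_left distrib_right)
  moreover have "(LINT x|lebesgue_on (region P). v x \<bullet> grad \<phi> x + (d x + c x) * \<phi> x)
      = outward_sign n P i * edge_integral P i (\<lambda>s. poly g s * \<phi> (edge_point n P i s))"
    using g dc \<phi> supp unfolding normal_trace_def by blast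
  moreover have "(LINT x|lebesgue_on (region P). w x \<bullet> grad \<phi> x + c x * \<phi> x)
      = outward_sign n P i * edge_integral P i (\<lambda>s. poly h s * \<phi> (edge_point n P i s))"
    using h c \<phi> supp unfolding normal_trace_def by blast
  moreover have "edge_integral P i (\<lambda>s. poly (g - h) s * \<phi> (edge_point n P i s))
      = edge_integral P i (\<lambda>s. poly g s * \<phi> (edge_point n P i s))
        - edge_integral P i (\<lambda>s. poly h s * \<phi> (edge_point n P i s))"
    unfolding edge_integral_def
    by (subst integral_diff[symmetric]) (auto intro!: edge_integrable cont simp: algebra_simps)
  ultimately show "(LINT x|lebesgue_on (region P). (v x - w x) \<bullet> grad \<phi> x + d x * \<phi> x) =
       outward_sign n P i * edge_integral P i (\<lambda>s. poly (g - h) s * \<phi> (edge_point n P i s))"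
    by (simp add: right_diff_distrib)
qed

lemma simple_polygon_vtx_neq:
  assumes "simple_polygon P" "i < length P" shows "vtx P i \<noteq> vtx P (Suc i)"
proof -
  have "3 \<le> length P" "distinct P" using assms by (auto simp: simple_polygon_def)
  moreover have "i mod length P \<noteq> Suc i mod length P"
    using assms(2) \<open>3 \<le> length P\<close> by (auto simp: mod_Suc)
  moreover have "Suc i mod length P < length P"
    using assms(2) by (intro mod_less_divisor) linarith
  ultimately show ?thesis using assms(2) by (simp add: vtx_def nth_eq_iff_index_eq)
qed

text \<open>In the plane, an edge vector orthogonal to the unit vector \<open>N\<close> equals
  \<open>t *\<^sub>R perp N\<close>, where \<open>t\<close> is the edge length up to sign. The sign
  depends on the chosen normal, so the segment parameter is \<open>1 / 2 + s / t\<close>, which lies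
  strictly between 0 and 1 for either orientation.\<close>

lemma edge_point_in_open_segment:
  assumes P: "simple_polygon P" "i < length P"
    and n: "norm (n (edge P i)) = 1" "n (edge P i) \<bullet> (vtx P (Suc i) - vtx P i) = 0"
    and s: "\<bar>s\<bar> < edge_length P i / 2"
  shows "edge_point n P i s \<in> open_segment (vtx P i) (vtx P (Suc i))"
proof -
  define a b N where "a = vtx P i" and "b = vtx P (Suc i)" and "N = n (edge P i)"
  define l where "l = edge_length P i"
  have ab: "a \<noteq> b" using simple_polygon_vtx_neq[OF P] by (simp add: a_def b_def)
  then have l: "0 < l" by (simp add: l_def edge_length_def a_def b_def)
  have l2: "l\<^sup>2 = (b$1 - a$1)\<^sup>2 + (b$2 - a$2)\<^sup>2"
    by (auto simp: l_def edge_length_def a_def b_def dist_norm norm_vec_def L2_set_def sum_2 power2_commute)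
  have N1: "(N$1)\<^sup>2 + (N$2)\<^sup>2 = 1"
    using n(1) by (simp add: N_def norm_vec_def L2_set_def sum_2)
  have N0: "N$1 * (b$1 - a$1) + N$2 * (b$2 - a$2) = 0"
    using n(2) by (simp add: N_def a_def b_def inner_vec_def sum_2)
  define t where "t = perp N \<bullet> (b - a)"
  have t: "t = N$1 * (b$2 - a$2) - N$2 * (b$1 - a$1)"
    by (simp add: t_def perp_def inner_vec_def sum_2)
  have ba: "b - a = t *\<^sub>R perp N"
  proof -
    have "b$1 - a$1 = t * - N$2" "b$2 - a$2 = t * N$1"
      using N1 N0 unfolding t by algebra+
    then show ?thesis by (auto simp: vec_eq_iff forall_2 perp_def)
  qed
  have "t\<^sup>2 = l\<^sup>2" using N1 N0 l2 unfolding t by algebra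
  then have tl: "\<bar>t\<bar> = l" using l by (metis abs_of_pos power2_eq_iff abs_minus_cancel)
  define u where "u = 1 / 2 + s / t"
  have t0: "t \<noteq> 0" using tl l by auto
  have "\<bar>s / t\<bar> < 1 / 2" using s tl l by (simp add: l_def[symmetric] abs_divide field_simps)
  then have u: "0 < u" "u < 1" unfolding u_def by linarith+
  have "edge_point n P i s = (1 - u) *\<^sub>R a + u *\<^sub>R b"
  proof -
    have "(1 - u) *\<^sub>R a + u *\<^sub>R b = a + u *\<^sub>R (b - a)" by (simp add: algebra_simps)
    also have "\<dots> = a + (1 / 2) *\<^sub>R (b - a) + (s / t) *\<^sub>R (t *\<^sub>R perp N)"
      unfolding u_def scaleR_add_left ba[symmetric] by (simp only: add.assoc)
    also have "a + (1 / 2) *\<^sub>R (b - a) = midpoint a b"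
      by (simp add: midpoint_def vec_eq_iff field_simps)
    also have "(s / t) *\<^sub>R (t *\<^sub>R perp N) = s *\<^sub>R perp N" using t0 by simp
    finally show ?thesis by (simp add: edge_point_def a_def b_def N_def)
  qed
  then show ?thesis using ab u by (auto simp: in_segment a_def b_def)
qed

text \<open>The edge moments use \<open>THE g. normal_trace n P i v g\<close>, a junk value unless the trace is
  unique. A nonzero difference of two traces keeps its sign near some point of the open edge, and is
  detected there by a bump function whose support avoids the other edges.\<close>

lemma normal_trace_unique:
  assumes P: "simple_polygon P" "i < length P"
    and n: "norm (n (edge P i)) = 1" "n (edge P i) \<bullet> (vtx P (Suc i) - vtx P i) = 0"
    and v: "v \<in> H_div (region P)"
    and g: "normal_trace n P i v g" and h: "normal_trace n P i v h"
  shows "g = h"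
proof (rule ccontr)
  assume "g \<noteq> h"
  define f where "f = g - h"
  have f: "f \<noteq> 0" using \<open>g \<noteq> h\<close> by (simp add: f_def)
  define l where "l = edge_length P i / 2"
  have l: "0 < l" using simple_polygon_vtx_neq[OF P] by (simp add: l_def edge_length_def)
  have "infinite {-l<..<l}" using l by simp
  then obtain s0 where s0: "s0 \<in> {-l<..<l}" "poly f s0 \<noteq> 0"
    using finite_subset[OF _ poly_roots_finite[OF f], of "{-l<..<l}"] by blast
  define p where "p = edge_point n P i s0"
  have p: "p \<in> open_segment (vtx P i) (vtx P (Suc i))"
    unfolding p_def using s0 by (intro edge_point_in_open_segment P n) (auto simp: l_def)
  \<comment> \<open>A ball around \<open>p\<close> that misses \<open>K\<close> meets the boundary
    only in the relative interior of edge \<open>i\<close>, as the test functions in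
    \<open>normal_trace\<close> require.\<close>
  define K where "K = (\<Union>j\<in>{..<length P} - {i}. edge P j) \<union> {vtx P i, vtx P (Suc i)}"
  have "p \<notin> K"
  proof
    assume "p \<in> K"
    moreover have "p \<notin> {vtx P i, vtx P (Suc i)}" using p by (auto simp: open_segment_def)
    ultimately obtain j where j: "j < length P" "j \<noteq> i" "p \<in> edge P j" by (auto simp: K_def)
    moreover have "p \<in> edge P i" using p by (auto simp: edge_def open_segment_def)
    moreover have "edge P i \<inter> edge P j = {vtx P i, vtx P (Suc i)} \<inter> {vtx P j, vtx P (Suc j)}"
      using P j unfolding simple_polygon_def by metis
    ultimately have "p \<in> {vtx P i, vtx P (Suc i)}" by blast
    then show False using \<open>p \<notin> {vtx P i, vtx P (Suc i)}\<close> by simp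
  qed
  moreover have "closed K"
  proof -
    have "closed (\<Union>j\<in>{..<length P} - {i}. edge P j)"
      by (rule closed_UN) (simp_all add: edge_def)
    then show ?thesis unfolding K_def by (rule closed_Un) simp
  qed
  ultimately obtain e1 where e1: "0 < e1" "\<And>x. x \<in> K \<Longrightarrow> e1 \<le> dist p x"
    using separate_point_closed[of K p] by auto
  have "isCont (poly f) s0" by simp
  \<comment> \<open>Within distance \<open>e2\<close> of \<open>s0\<close> the polynomial
    \<open>f\<close> keeps the sign of \<open>poly f s0\<close>.\<close>
  then obtain e2 where e2: "0 < e2" "\<And>s. \<bar>s - s0\<bar> < e2 \<Longrightarrow> \<bar>poly f s - poly f s0\<bar> < \<bar>poly f s0\<bar>"
    using s0(2) unfolding continuous_at_eps_delta dist_real_def by (metis zero_less_abs_iff)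
  define e where "e = min e1 e2 / 2"
  have e: "0 < e" "e < e1" "e < e2" using e1 e2 by (auto simp: e_def)
  obtain \<phi> where \<phi>: "smooth_cpt \<phi>" "supp \<phi> \<subseteq> cball p e" "\<And>x. 0 \<le> \<phi> x" "\<phi> p \<noteq> 0"
    using smooth_bump[OF e(1)] by metis
  have supp: "supp \<phi> \<inter> frontier (region P) \<subseteq> open_segment (vtx P i) (vtx P (Suc i))"
  proof
    fix x assume x: "x \<in> supp \<phi> \<inter> frontier (region P)"
    then have "dist p x < e1" using \<phi>(2) e by auto
    then have "x \<notin> K" using e1(2) by force
    moreover have "x \<in> (\<Union>i<length P. edge P i)" using x frontier_region by auto
    ultimately have "x \<in> edge P i" "x \<notin> {vtx P i, vtx P (Suc i)}" by (auto simp: K_def)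
    then show "x \<in> open_segment (vtx P i) (vtx P (Suc i))" by (auto simp: edge_def open_segment_def)
  qed
  obtain d where d: "L2_on (region P) d" "weak_div (region P) v d" using v by (auto simp: H_div_def)
  have cont: "continuous_on UNIV \<phi>" by (rule smooth_cpt_continuous[OF \<phi>(1)])
  have "outward_sign n P i * edge_integral P i (\<lambda>s. poly f s * \<phi> (edge_point n P i s))
      = (LINT x|lebesgue_on (region P). v x \<bullet> grad \<phi> x + d x * \<phi> x)"
    if "normal_trace n P i v f" for f
    using that d \<phi>(1) supp unfolding normal_trace_def by simp
  from this[OF g] this[OF h] have "outward_sign n P i * edge_integral P i (\<lambda>s. poly g s * \<phi> (edge_point n P i s))
      = outward_sign n P i * edge_integral P i (\<lambda>s. poly h s * \<phi> (edge_point n P i s))"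
    by simp
  \<comment> \<open>The sign factor is 1 or -1 and cancels.\<close>
  then have "edge_integral P i (\<lambda>s. poly g s * \<phi> (edge_point n P i s))
      = edge_integral P i (\<lambda>s. poly h s * \<phi> (edge_point n P i s))"
    by (simp add: outward_sign_def split: if_splits)
  moreover have "edge_integral P i (\<lambda>s. poly f s * \<phi> (edge_point n P i s))
      = edge_integral P i (\<lambda>s. poly g s * \<phi> (edge_point n P i s))
        - edge_integral P i (\<lambda>s. poly h s * \<phi> (edge_point n P i s))"
    unfolding edge_integral_def f_def
    by (subst integral_diff[symmetric]) (auto intro!: edge_integrable cont simp: algebra_simps)
  ultimately have "integral {-l..l} (\<lambda>s. poly f s * \<phi> (edge_point n P i s)) = 0"
    by (simp add: edge_integral_def l_def)
  \<comment> \<open>Multiplication by the constant \<open>poly f s0\<close> makes the integrand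
    nonnegative on the support of the bump. A continuous nonnegative function with zero integral
    vanishes, which fails at \<open>s0\<close>.\<close>
  then have 0: "integral {-l..l} (\<lambda>s. poly f s0 * (poly f s * \<phi> (edge_point n P i s))) = 0"
    by simp
  have dist_edge: "dist p (edge_point n P i s) = \<bar>s - s0\<bar>" for s
  proof -
    have "p - edge_point n P i s = (s0 - s) *\<^sub>R perp (n (edge P i))"
      by (simp add: p_def edge_point_def scaleR_diff_left)
    moreover have "norm (perp (n (edge P i))) = 1"
      using n(1) by (simp add: norm_vec_def L2_set_def sum_2 perp_def add.commute)
    ultimately show ?thesis by (simp add: dist_norm abs_minus_commute)
  qed
  have "0 \<le> poly f s0 * (poly f s * \<phi> (edge_point n P i s))" for s
  proof (cases "\<phi> (edge_point n P i s) = 0")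
    case False
    then have "edge_point n P i s \<in> supp \<phi>"
      unfolding supp_def by (intro subsetD[OF closure_subset]) simp
    then have "\<bar>s - s0\<bar> < e2" using \<phi>(2) e dist_edge[of s] by auto
    then have "\<bar>poly f s - poly f s0\<bar> < \<bar>poly f s0\<bar>" by (rule e2(2))
    then have "0 \<le> poly f s0 * poly f s" by (auto simp: zero_le_mult_iff)
    then show ?thesis using \<phi>(3) by (simp flip: mult.assoc)
  qed simp
  moreover have "continuous_on {-l..l} (\<lambda>s. poly f s0 * (poly f s * \<phi> (edge_point n P i s)))"
    by (intro continuous_intros continuous_on_compose2[OF cont continuous_on_edge_point]) auto
  ultimately have zero: "\<forall>s\<in>{-l..l}. poly f s0 * (poly f s * \<phi> (edge_point n P i s)) = 0"
    using integral_eq_0_iff[of "-l" l "\<lambda>s. poly f s0 * (poly f s * \<phi> (edge_point n P i s))"] 0 l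
    by (simp del: mult_eq_0_iff)
  have "s0 \<in> {-l..l}" using s0(1) by simp
  then have "poly f s0 * (poly f s0 * \<phi> p) = 0" using zero unfolding p_def by blast
  then show False using s0(2) \<phi>(4) by simp
qed

section \<open>Linearity of the degrees of freedom\<close>

lemma normal_component_eq:
  assumes "simple_polygon P" "i < length P"
    and "norm (n (edge P i)) = 1" "n (edge P i) \<bullet> (vtx P (Suc i) - vtx P i) = 0"
    and "v \<in> H_div (region P)" and "normal_trace n P i v g"
  shows "normal_component n P i v = g"
  unfolding normal_component_def using assms by (blast intro: the_equality normal_trace_unique)

lemma smooth_expr_scaled_monomial: "smooth_expr (scaled_monomial P a b)"
proof -
  have "smooth_expr (\<lambda>x. ((x $ 1 - barycenter P $ 1) * inverse (diam P)) ^ a *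
      ((x $ 2 - barycenter P $ 2) * inverse (diam P)) ^ b)"
    by (intro smooth_expr.mult smooth_expr_power smooth_expr_diff smooth_expr.const smooth_expr.coord)
  then show ?thesis by (simp add: scaled_monomial_def[abs_def] divide_inverse)
qed

text \<open>For edge moments, uniqueness identifies the normal component of the difference with the
  difference of the traces; membership in \<open>dof_indices k P\<close> guarantees that the edge
  exists. The other moments integrate the field against a continuous vector function and split by
  integrability.\<close>

lemma dof_diff:
  assumes P: "simple_polygon P"
    and n: "\<And>i. i < length P \<Longrightarrow> norm (n (edge P i)) = 1"
      "\<And>i. i < length P \<Longrightarrow> n (edge P i) \<bullet> (vtx P (Suc i) - vtx P i) = 0"
    and w: "w \<in> V_h k n P" and z: "z \<in> V_h k n P" and j: "j \<in> dof_indices k P"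
  shows "dof n P (\<lambda>x. w x - z x) j = dof n P w j - dof n P z j"
proof -
  note E = open_region[of P] bounded_region[of P]
  have wz: "w \<in> H_div (region P)" "z \<in> H_div (region P)" using w z by (auto simp: V_h_def)
  then have L2: "L2_on (region P) w" "L2_on (region P) z" by (auto simp: H_div_def)
  have moment: "(LINT x|lebesgue_on (region P). (w x - z x) \<bullet> g x)
      = (LINT x|lebesgue_on (region P). w x \<bullet> g x) - (LINT x|lebesgue_on (region P). z x \<bullet> g x)"
    if "continuous_on UNIV g" for g
    using integrable_L2_inner[OF E L2(1) that] integrable_L2_inner[OF E L2(2) that]
    by (simp add: inner_diff_left)
  show ?thesis
  proof (cases j)
    case (Edge_Moment i a)
    then have i: "i < length P" using j by (auto simp: dof_indices_def)
    obtain g h where gh: "normal_trace n P i w g" "normal_trace n P i z h"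
      using w z i unfolding V_h_def by blast
    have "normal_component n P i w = g" "normal_component n P i z = h"
      "normal_component n P i (\<lambda>x. w x - z x) = g - h"
      using normal_component_eq[of P i n, OF P i n[OF i]] wz gh H_div_diff[OF E wz] normal_trace_diff[OF wz gh]
      by auto
    moreover have int: "(\<lambda>s. poly p s * (s / l) ^ a) integrable_on {x..y}" for p and l x y :: real
      unfolding divide_inverse by (intro integrable_continuous_real continuous_intros)
    have "edge_integral P i (\<lambda>s. poly (g - h) s * (s / edge_length P i) ^ a)
      = edge_integral P i (\<lambda>s. poly g s * (s / edge_length P i) ^ a)
        - edge_integral P i (\<lambda>s. poly h s * (s / edge_length P i) ^ a)"
      unfolding edge_integral_def integral_diff[OF int int, symmetric]
      by (simp add: left_diff_distrib)
    ultimately show ?thesis using Edge_Moment by (simp add: diff_divide_distrib)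
  next
    case (Grad_Moment a b)
    have "continuous_on UNIV (grad (scaled_monomial P a b))"
      unfolding grad_def
      by (intro continuous_on_vec_lambda smooth_expr_continuous smooth_expr_partial
          smooth_expr_scaled_monomial)
    from moment[OF this] Grad_Moment show ?thesis by (simp add: right_diff_distrib diff_divide_distrib)
  next
    case (Perp_Moment a b)
    define g where "g x = scaled_monomial P a b x *\<^sub>R perp ((1 / diam P) *\<^sub>R (x - barycenter P))" for x
    have "linear perp" by (intro linearI) (auto simp: perp_def vec_eq_iff forall_2)
    then have "continuous_on UNIV perp" by (simp add: linear_continuous_on linear_conv_bounded_linear)
    then have "continuous_on UNIV (\<lambda>x. perp ((1 / diam P) *\<^sub>R (x - barycenter P)))"
      by (rule continuous_on_compose2) (intro continuous_intros, simp)
    then have "continuous_on UNIV g"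
      unfolding g_def
      by (intro continuous_on_scaleR smooth_expr_continuous smooth_expr_scaled_monomial)
    from moment[OF this] Perp_Moment show ?thesis
      by (simp add: g_def mult.commute right_diff_distrib diff_divide_distrib)
  qed
qed

section \<open>Estimates for the forms\<close>

text \<open>Writing \<open>G powr (q - 1)\<close> and \<open>H\<close> as powers of
  \<open>r\<close>-th powers exposes the exponents \<open>(r - q) / r\<close>,
  \<open>(q - 1) / r\<close> and \<open>1 / r\<close> used in Hoelder's inequality.\<close>

lemma powr_split_bound:
  fixes r q X F G H :: real
  assumes r: "1 < r" and nn: "0 \<le> G" "0 \<le> H"
    and X: "X \<le> (r + 4) * F powr ((r - q) / r) * G powr (q - 1)"
  shows "X * H \<le> (r + 4) * (F powr ((r - q) / r) * (G powr r) powr ((q - 1) / r) * (H powr r) powr (1 / r))"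
  using mult_right_mono[OF X nn(2)] r nn by (simp add: powr_powr mult.assoc)

text \<open>Adding and subtracting a mixed term in the flux difference \<open>D\<close>, in the two
  possible ways, gives the two bounds assumed by \<open>flux_difference_bound\<close>.
  Cauchy-Schwarz then passes from \<open>D\<close> to its inner product with
  \<open>v\<close>.\<close>

lemma flux_difference_inner:
  fixes w z v :: "'a::real_inner"
  assumes r: "1 < r" and q: "q = min r 2"
  shows "\<bar>norm w powr (r - 2) * (w \<bullet> v) - norm z powr (r - 2) * (z \<bullet> v)\<bar>
    \<le> (r + 4) * ((norm w powr r + norm z powr r) powr ((r - q) / r)
      * (norm (w - z) powr r) powr ((q - 1) / r) * (norm v powr r) powr (1 / r))"
proof -
  define D where "D = (norm w powr (r - 2)) *\<^sub>R w - (norm z powr (r - 2)) *\<^sub>R z"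
  have tri: "norm w \<le> norm z + norm (w - z)" "norm z \<le> norm w + norm (w - z)"
    using norm_triangle_sub[of w z] norm_triangle_sub[of z w] by (simp_all add: norm_minus_commute)
  have D1: "norm D \<le> norm w powr (r - 2) * norm (w - z)
      + \<bar>norm w powr (r - 2) - norm z powr (r - 2)\<bar> * norm z"
  proof -
    have "D = (norm w powr (r - 2)) *\<^sub>R (w - z) + (norm w powr (r - 2) - norm z powr (r - 2)) *\<^sub>R z"
      by (simp add: D_def algebra_simps)
    then show ?thesis by (metis norm_triangle_ineq norm_scaleR abs_of_nonneg powr_ge_zero)
  qed
  have D2: "norm D \<le> norm z powr (r - 2) * norm (w - z)
      + \<bar>norm w powr (r - 2) - norm z powr (r - 2)\<bar> * norm w"
  proof -
    have "D = (norm z powr (r - 2)) *\<^sub>R (w - z) + (norm w powr (r - 2) - norm z powr (r - 2)) *\<^sub>R w"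
      by (simp add: D_def algebra_simps)
    then show ?thesis by (metis norm_triangle_ineq norm_scaleR abs_of_nonneg powr_ge_zero)
  qed
  have "norm D \<le> (r + 4) * (norm w powr r + norm z powr r) powr ((r - q) / r) * norm (w - z) powr (q - 1)"
    by (rule flux_difference_bound[OF r q _ _ _ tri norm_triangle_ineq4 D1 D2]) simp_all
  then have "norm D * norm v \<le> (r + 4) * ((norm w powr r + norm z powr r) powr ((r - q) / r)
      * (norm (w - z) powr r) powr ((q - 1) / r) * (norm v powr r) powr (1 / r))"
    by (intro powr_split_bound r) auto
  moreover have "norm w powr (r - 2) * (w \<bullet> v) - norm z powr (r - 2) * (z \<bullet> v) = D \<bullet> v"
    by (simp add: D_def inner_diff_left)
  ultimately show ?thesis using Cauchy_Schwarz_ineq2[of D v] by linarith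
qed

section \<open>The flux inequality for vectors over an index set\<close>

lemma L2_set_scale: "L2_set (\<lambda>i. c * f i) A = \<bar>c\<bar> * L2_set f A"
  by (simp add: L2_set_def power_mult_distrib real_sqrt_mult flip: sum_distrib_left)

lemma L2_set_inner_le: "\<bar>\<Sum>i\<in>A. f i * g i\<bar> \<le> L2_set f A * L2_set g A"
proof -
  have "\<bar>\<Sum>i\<in>A. f i * g i\<bar> \<le> (\<Sum>i\<in>A. \<bar>f i\<bar> * \<bar>g i\<bar>)"
    using sum_abs[of "\<lambda>i. f i * g i" A] by (simp add: abs_mult)
  then show ?thesis using L2_set_mult_ineq[of f g A] by linarith
qed

text \<open>The argument for norms carries over to \<open>L2_set\<close>. The constant does not
  depend on \<open>A\<close>, hence not on the number of degrees of freedom.\<close>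

lemma flux_difference_L2_set:
  fixes f g h :: "'i \<Rightarrow> real"
  assumes r: "1 < r" and q: "q = min r 2"
  shows "\<bar>L2_set f A powr (r - 2) * (\<Sum>i\<in>A. f i * h i) - L2_set g A powr (r - 2) * (\<Sum>i\<in>A. g i * h i)\<bar>
    \<le> (r + 4) * ((L2_set f A powr r + L2_set g A powr r) powr ((r - q) / r)
      * (L2_set (\<lambda>i. f i - g i) A powr r) powr ((q - 1) / r) * (L2_set h A powr r) powr (1 / r))"
proof -
  let ?N = "\<lambda>f. L2_set f A"
  let ?a = "?N f powr (r - 2)" and ?b = "?N g powr (r - 2)"
  have sym: "?N (\<lambda>i. g i - f i) = ?N (\<lambda>i. f i - g i)"
    by (simp add: L2_set_def power2_commute)
  have tri: "?N f \<le> ?N g + ?N (\<lambda>i. f i - g i)" "?N g \<le> ?N f + ?N (\<lambda>i. f i - g i)"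
    "?N (\<lambda>i. f i - g i) \<le> ?N f + ?N g"
    using L2_set_triangle_ineq[of g "\<lambda>i. f i - g i" A] L2_set_triangle_ineq[of f "\<lambda>i. g i - f i" A]
      L2_set_triangle_ineq[of f "\<lambda>i. - 1 * g i" A] L2_set_scale[of "-1" g A]
    by (simp_all add: sym)
  define D where "D i = ?a * f i - ?b * g i" for i
  have D1: "?N D \<le> ?a * ?N (\<lambda>i. f i - g i) + \<bar>?a - ?b\<bar> * ?N g"
  proof -
    have "D = (\<lambda>i. ?a * (f i - g i) + (?a - ?b) * g i)" by (simp add: fun_eq_iff D_def algebra_simps)
    then show ?thesis
      using L2_set_triangle_ineq[of "\<lambda>i. ?a * (f i - g i)" "\<lambda>i. (?a - ?b) * g i" A]
      by (simp only: L2_set_scale abs_of_nonneg powr_ge_zero)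
  qed
  have D2: "?N D \<le> ?b * ?N (\<lambda>i. f i - g i) + \<bar>?a - ?b\<bar> * ?N f"
  proof -
    have "D = (\<lambda>i. ?b * (f i - g i) + (?a - ?b) * f i)" by (simp add: fun_eq_iff D_def algebra_simps)
    then show ?thesis
      using L2_set_triangle_ineq[of "\<lambda>i. ?b * (f i - g i)" "\<lambda>i. (?a - ?b) * f i" A]
      by (simp only: L2_set_scale abs_of_nonneg powr_ge_zero)
  qed
  have "?N D \<le> (r + 4) * (?N f powr r + ?N g powr r) powr ((r - q) / r) * ?N (\<lambda>i. f i - g i) powr (q - 1)"
    by (rule flux_difference_bound[OF r q _ _ _ tri D1 D2]) simp_all
  then have "?N D * ?N h \<le> (r + 4) * ((?N f powr r + ?N g powr r) powr ((r - q) / r)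
      * (?N (\<lambda>i. f i - g i) powr r) powr ((q - 1) / r) * (?N h powr r) powr (1 / r))"
    by (intro powr_split_bound r) auto
  moreover have "?a * (\<Sum>i\<in>A. f i * h i) - ?b * (\<Sum>i\<in>A. g i * h i) = (\<Sum>i\<in>A. D i * h i)"
    by (simp add: D_def sum_distrib_left sum_subtractf left_diff_distrib mult.assoc)
  ultimately show ?thesis using L2_set_inner_le[of D h A] by linarith
qed

section \<open>Powers of extended nonnegative reals\<close>

lemma epowr_ennreal: "0 < t \<Longrightarrow> epowr (ennreal t) s = ennreal (t powr s)"
  by (simp add: epowr_def)

lemma epowr_top: "s \<noteq> 0 \<Longrightarrow> epowr top s = top"
  by (simp add: epowr_def)

lemma epowr_neq_0: "x \<noteq> 0 \<Longrightarrow> epowr x s \<noteq> 0"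
  by (auto simp: epowr_def enn2real_eq_0_iff)

lemma epowr_1: "epowr x 1 = x"
  by (auto simp: epowr_def ennreal_enn2real_if)

lemma epowr_epowr: "s \<noteq> 0 \<Longrightarrow> t \<noteq> 0 \<Longrightarrow> epowr (epowr x s) t = epowr x (s * t)"
  by (auto simp: epowr_def powr_powr)

text \<open>For \<open>r > 2\<close> the integrals may be infinite; the products with a vanishing factor
  (where \<open>\<infinity> * 0 = 0\<close>) are harmless because then the fluxes agree almost everywhere. For
  \<open>r \<le> 2\<close> the first exponent is zero and does not see an infinite integral, which the finiteness
  assumptions exclude.\<close>

lemma flux_integral_difference:
  fixes w z v :: "'a \<Rightarrow> 'b::euclidean_space"
  assumes r: "1 < r" and q: "q = min r 2"
    and meas [measurable]: "w \<in> borel_measurable M" "z \<in> borel_measurable M" "v \<in> borel_measurable M"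
    and fin: "r \<le> 2 \<Longrightarrow> (\<integral>\<^sup>+x. norm (w x) powr r + norm (z x) powr r \<partial>M) \<noteq> \<infinity>"
      "r \<le> 2 \<Longrightarrow> (\<integral>\<^sup>+x. norm (w x - z x) powr r \<partial>M) \<noteq> \<infinity>"
      "r \<le> 2 \<Longrightarrow> (\<integral>\<^sup>+x. norm (v x) powr r \<partial>M) \<noteq> \<infinity>"
  shows "ennreal \<bar>(LINT x|M. norm (w x) powr (r - 2) * (w x \<bullet> v x))
        - (LINT x|M. norm (z x) powr (r - 2) * (z x \<bullet> v x))\<bar>
    \<le> ennreal (r + 4) * epowr (\<integral>\<^sup>+x. norm (w x) powr r + norm (z x) powr r \<partial>M) ((r - q) / r)
      * epowr (\<integral>\<^sup>+x. norm (w x - z x) powr r \<partial>M) ((q - 1) / r)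
      * epowr (\<integral>\<^sup>+x. norm (v x) powr r \<partial>M) (1 / r)"
proof -
  define F G H where "F x = norm (w x) powr r + norm (z x) powr r"
    and "G x = norm (w x - z x) powr r" and "H x = norm (v x) powr r" for x
  define a b c where "a = (r - q) / r" and "b = (q - 1) / r" and "c = 1 / r"
  have abc: "0 \<le> a" "0 < b" "0 < c" "a + b + c = 1" "2 < r \<Longrightarrow> a \<noteq> 0"
    using r q by (auto simp: a_def b_def c_def add_divide_distrib[symmetric])
  have [measurable]: "F \<in> borel_measurable M" "G \<in> borel_measurable M" "H \<in> borel_measurable M"
    unfolding F_def[abs_def] G_def[abs_def] H_def[abs_def] by measurable
  have nn: "0 \<le> F x" "0 \<le> G x" "0 \<le> H x" for x by (auto simp: F_def G_def H_def)
  define flux where "flux u x = norm (u x) powr (r - 2) * (u x \<bullet> v x)" for u :: "'a \<Rightarrow> 'b" and x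
  have [measurable]: "flux u \<in> borel_measurable M" if [measurable]: "u \<in> borel_measurable M" for u
    unfolding flux_def[abs_def] by measurable
  have pt: "\<bar>flux w x - flux z x\<bar> \<le> (r + 4) * (F x powr a * G x powr b * H x powr c)" for x
    unfolding flux_def F_def G_def H_def a_def b_def c_def by (rule flux_difference_inner[OF r q])
  have "ennreal \<bar>integral\<^sup>L M (flux w) - integral\<^sup>L M (flux z)\<bar>
    \<le> ennreal (r + 4) * epowr (integral\<^sup>N M F) a * epowr (integral\<^sup>N M G) b * epowr (integral\<^sup>N M H) c"
  proof (cases "integral\<^sup>N M F = 0 \<or> integral\<^sup>N M G = 0 \<or> integral\<^sup>N M H = 0")
    case True
    then have "(AE x in M. F x = 0) \<or> (AE x in M. G x = 0) \<or> (AE x in M. H x = 0)"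
      using nn by (simp add: nn_integral_0_iff_AE order_antisym_conv)
    then have "AE x in M. F x = 0 \<or> G x = 0 \<or> H x = 0" by auto
    then have "AE x in M. flux w x = flux z x"
    proof eventually_elim
      case (elim x)
      \<comment> \<open>The pointwise bound is zero also when \<open>F x = 0\<close> and
        \<open>a = 0\<close>, because \<open>0 powr 0 = 0\<close>.\<close>
      then show ?case using pt[of x] by auto
    qed
    then have "integral\<^sup>L M (flux w) = integral\<^sup>L M (flux z)" by (intro integral_cong_AE) auto
    then show ?thesis by simp
  next
    case nz: False
    show ?thesis
    proof (cases "integral\<^sup>N M F = \<infinity> \<or> integral\<^sup>N M G = \<infinity> \<or> integral\<^sup>N M H = \<infinity>")
      case True
      \<comment> \<open>Finiteness for \<open>r \<le> 2\<close> leaves only \<open>2 < r\<close>.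
        All three exponents are then nonzero and no factor vanishes, so the right-hand side is
        infinite.\<close>
      then have "2 < r" using fin unfolding F_def G_def H_def by (cases "r \<le> 2") auto
      then have "ennreal (r + 4) * epowr (integral\<^sup>N M F) a * epowr (integral\<^sup>N M G) b
          * epowr (integral\<^sup>N M H) c = \<infinity>"
        using True nz abc r by (auto simp: ennreal_mult_eq_top_iff epowr_top epowr_neq_0)
      then show ?thesis by simp
    next
      case False
      have int: "integrable M F" "integrable M G" "integrable M H"
        using False nn by (auto intro!: integrableI_nonneg simp: less_top)
      have eq: "integral\<^sup>N M F = ennreal (integral\<^sup>L M F)" "integral\<^sup>N M G = ennreal (integral\<^sup>L M G)"
        "integral\<^sup>N M H = ennreal (integral\<^sup>L M H)"
        using int nn by (auto intro!: nn_integral_eq_integral)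
      have pos: "0 < integral\<^sup>L M F" "0 < integral\<^sup>L M G" "0 < integral\<^sup>L M H"
        using nz nn unfolding eq by (auto simp: less_le ennreal_eq_0_iff integral_nonneg)
      have "0 \<le> b" "0 \<le> c" using abc by auto
      note Holder = Holder3[OF abc(1) this abc(4) int nn pos]
      \<comment> \<open>The difference of the integrals is the integral of the difference only if
        each flux is integrable. The flux inequality against the zero field, followed by AM-GM,
        bounds a single flux by a multiple of \<open>F + H\<close>.\<close>
      have flux_int: "integrable M (flux u)"
        if [measurable]: "u \<in> borel_measurable M" and u: "\<And>x. norm (u x) powr r \<le> F x" for u
      proof (rule Bochner_Integration.integrable_bound)
        show "integrable M (\<lambda>x. (r + 4) * (F x + H x))" using int by auto
        show "AE x in M. norm (flux u x) \<le> norm ((r + 4) * (F x + H x))"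
        proof (rule AE_I2)
          fix x
          define U where "U = norm (u x) powr r"
          have U: "0 \<le> U" "U \<le> F x" using u by (auto simp: U_def)
          have "\<bar>flux u x\<bar> \<le> (r + 4) * (U powr a * U powr b * H x powr c)"
            using flux_difference_inner[OF r q, of "u x" "v x" 0] r
            by (simp add: flux_def U_def H_def a_def b_def c_def)
          also have "\<dots> \<le> (r + 4) * (a * U + b * U + c * H x)"
            using abc nn U r by (intro mult_left_mono weighted_am_gm3) auto
          also have "\<dots> \<le> (r + 4) * (1 * F x + 1 * H x)"
            unfolding distrib_right[symmetric]
            using abc nn U r by (intro mult_left_mono add_mono mult_mono) auto
          finally show "norm (flux u x) \<le> norm ((r + 4) * (F x + H x))"
            using nn r by simp
        qed
      qed measurable
      have fi: "integrable M (flux w)" "integrable M (flux z)"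
        by (auto intro!: flux_int simp: F_def)
      have "\<bar>integral\<^sup>L M (flux w) - integral\<^sup>L M (flux z)\<bar> = \<bar>LINT x|M. flux w x - flux z x\<bar>"
        using fi by simp
      also have "\<dots> \<le> (LINT x|M. \<bar>flux w x - flux z x\<bar>)" by (rule integral_abs_bound)
      also have "\<dots> \<le> (LINT x|M. (r + 4) * (F x powr a * G x powr b * H x powr c))"
        using fi Holder(1) by (intro integral_mono pt) auto
      also have "\<dots> = (r + 4) * (LINT x|M. F x powr a * G x powr b * H x powr c)" by simp
      also have "\<dots> \<le> (r + 4) * (integral\<^sup>L M F powr a * integral\<^sup>L M G powr b * integral\<^sup>L M H powr c)"
        using r by (intro mult_left_mono Holder(2)) auto
      finally show ?thesis
        using r pos unfolding eq
        by (simp add: epowr_ennreal ennreal_mult'[symmetric] mult.assoc ennreal_leI del: ennreal_plus)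
    qed
  qed
  then show ?thesis by (simp add: flux_def[abs_def] F_def G_def H_def a_def b_def c_def)
qed

text \<open>The bound \<open>t powr r \<le> 1 + t^2\<close> for \<open>r \<le> 2\<close>, on a set
  of finite measure, supplies the finiteness assumptions of
  \<open>flux_integral_difference\<close>.\<close>

lemma L2_on_powr_integral_finite:
  fixes f :: "point \<Rightarrow> 'b::euclidean_space"
  assumes E: "open E" "bounded E" and f: "L2_on E f" and r: "1 < r" "r \<le> 2"
  shows "(\<integral>\<^sup>+x. norm (f x) powr r \<partial>lebesgue_on E) < \<infinity>"
proof -
  have "emeasure (lebesgue_on E) (space (lebesgue_on E)) < \<infinity>"
    using E bounded_set_imp_lmeasurable[of E] by (auto simp: fmeasurable_def emeasure_restrict_space)
  then have "integrable (lebesgue_on E) (\<lambda>x. 1 + (norm (f x))\<^sup>2)"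
    using f by (intro Bochner_Integration.integrable_add
        finite_measure.integrable_const finite_measureI) (auto simp: L2_on_def)
  then have "(\<integral>\<^sup>+x. ennreal (1 + (norm (f x))\<^sup>2) \<partial>lebesgue_on E) < \<infinity>"
    by (simp add: nn_integral_eq_integral del: ennreal_plus)
  moreover have "norm (f x) powr r \<le> 1 + (norm (f x))\<^sup>2" for x
  proof (cases "norm (f x) \<le> 1")
    case True
    then have "norm (f x) powr r \<le> 1" using r powr_mono2[of r "norm (f x)" 1] by simp
    then show ?thesis by (simp add: add_increasing2)
  next
    case False
    then have "norm (f x) powr r \<le> norm (f x) powr 2" using r by (intro powr_mono) auto
    then show ?thesis using False by simp
  qed
  then have "(\<integral>\<^sup>+x. norm (f x) powr r \<partial>lebesgue_on E)
      \<le> (\<integral>\<^sup>+x. ennreal (1 + (norm (f x))\<^sup>2) \<partial>lebesgue_on E)"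
    by (intro nn_integral_mono ennreal_leI)
  ultimately show ?thesis by (rule order.strict_trans1[rotated])
qed

text \<open>The integral estimate is restated in norms. Only the nonzero exponents \<open>r\<close>
  and \<open>q - 1\<close> are moved through \<open>L_norm\<close>; the exponent
  \<open>(r - q) / r\<close>, which may be zero, stays on the sum of the two integrals.\<close>

lemma a_form_difference:
  assumes r: "1 < r" and q: "q = min r 2"
    and L2: "L2_on (region P) v" "L2_on (region P) w" "L2_on (region P) z"
  shows "ennreal \<bar>a_form r P w v - a_form r P z v\<bar>
    \<le> ennreal (r + 4) * epowr (epowr (L_norm r P w) r + epowr (L_norm r P z) r) ((r - q) / r)
      * epowr (L_norm r P (\<lambda>x. w x - z x)) (q - 1) * L_norm r P v"
proof -
  let ?M = "lebesgue_on (region P)"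
  have [measurable]: "v \<in> borel_measurable ?M" "w \<in> borel_measurable ?M" "z \<in> borel_measurable ?M"
    using L2 by (auto simp: L2_on_def)
  have pow: "epowr (L_norm r P u) s = epowr (\<integral>\<^sup>+x. norm (u x) powr r \<partial>?M) (s / r)"
    if "s \<noteq> 0" for u s
    using r that by (simp add: L_norm_def epowr_epowr)
  have norm_r: "epowr (L_norm r P u) r = (\<integral>\<^sup>+x. norm (u x) powr r \<partial>?M)" for u
    using pow[of r u] r by (simp add: epowr_1)
  have norm_e: "epowr (L_norm r P (\<lambda>x. w x - z x)) (q - 1)
      = epowr (\<integral>\<^sup>+x. norm (w x - z x) powr r \<partial>?M) ((q - 1) / r)"
    using r q by (intro pow) auto
  have sum: "(\<integral>\<^sup>+x. norm (w x) powr r + norm (z x) powr r \<partial>?M)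
      = (\<integral>\<^sup>+x. norm (w x) powr r \<partial>?M) + (\<integral>\<^sup>+x. norm (z x) powr r \<partial>?M)"
    by (simp add: ennreal_plus nn_integral_add)
  note fin = L2_on_powr_integral_finite[OF open_region bounded_region _ r]
  have "ennreal \<bar>a_form r P w v - a_form r P z v\<bar>
    \<le> ennreal (r + 4) * epowr (\<integral>\<^sup>+x. norm (w x) powr r + norm (z x) powr r \<partial>?M) ((r - q) / r)
      * epowr (\<integral>\<^sup>+x. norm (w x - z x) powr r \<partial>?M) ((q - 1) / r)
      * epowr (\<integral>\<^sup>+x. norm (v x) powr r \<partial>?M) (1 / r)"
    unfolding a_form_def
  proof (rule flux_integral_difference[OF r q])
    show "(\<integral>\<^sup>+x. norm (w x) powr r + norm (z x) powr r \<partial>?M) \<noteq> \<infinity>" if "r \<le> 2"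
      unfolding sum using fin[OF L2(2) that] fin[OF L2(3) that] by (simp add: less_top)
    show "(\<integral>\<^sup>+x. norm (w x - z x) powr r \<partial>?M) \<noteq> \<infinity>" if "r \<le> 2"
      using fin[OF L2_on_diff[OF L2(2,3)] that] by simp
    show "(\<integral>\<^sup>+x. norm (v x) powr r \<partial>?M) \<noteq> \<infinity>" if "r \<le> 2"
      using fin[OF L2(1) that] by simp
  qed measurable
  then show ?thesis
    unfolding sum norm_r norm_e L_norm_def[of r P v] .
qed

section \<open>The stabilisation form\<close>

lemma s_form_self:
  assumes "1 < r"
  shows "s_form r k n P v v = (diam P)\<^sup>2 * L2_set (dof n P v) (dof_indices k P) powr r"
proof -
  let ?N = "L2_set (dof n P v) (dof_indices k P)"
  have "(\<Sum>j\<in>dof_indices k P. dof n P v j * dof n P v j) = ?N\<^sup>2"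
    by (simp add: L2_set_def sum_nonneg power2_eq_square)
  moreover have "?N powr (r - 2) * ?N\<^sup>2 = ?N powr r"
  proof (cases "?N = 0")
    case False
    then have "0 < ?N" by (simp add: less_le)
    then show ?thesis by (simp add: powr_diff)
  qed simp
  ultimately show ?thesis by (simp add: s_form_def mult.assoc)
qed

lemma s_form_difference:
  assumes r: "1 < r" and q: "q = min r 2"
    and dof: "\<And>j. j \<in> dof_indices k P \<Longrightarrow> dof n P e j = dof n P w j - dof n P z j"
  shows "\<bar>s_form r k n P w v - s_form r k n P z v\<bar>
    \<le> (r + 4) * (s_form r k n P w w + s_form r k n P z z) powr ((r - q) / r)
      * s_form r k n P e e powr ((q - 1) / r) * s_form r k n P v v powr (1 / r)"
proof -
  let ?I = "dof_indices k P"
  let ?N = "\<lambda>u. L2_set (dof n P u) ?I"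
  define h where "h = (diam P)\<^sup>2"
  have h: "0 \<le> h" by (simp add: h_def)
  have e: "?N e = L2_set (\<lambda>j. dof n P w j - dof n P z j) ?I"
    using dof by (intro L2_set_cong) auto
  \<comment> \<open>The exponents add up to one, so the weight \<open>h\<close> factors into the
    three powers that turn the norms of the degrees of freedom back into values of
    \<open>s_form\<close>.\<close>
  have "(r - q) / r + (q - 1) / r + 1 / r = 1" using r by (simp flip: add_divide_distrib)
  then have hp: "h powr ((r - q) / r) * h powr ((q - 1) / r) * h powr (1 / r) = h"
    using h by (simp flip: powr_add)
  have "\<bar>s_form r k n P w v - s_form r k n P z v\<bar>
    = h * \<bar>?N w powr (r - 2) * (\<Sum>j\<in>?I. dof n P w j * dof n P v j)
        - ?N z powr (r - 2) * (\<Sum>j\<in>?I. dof n P z j * dof n P v j)\<bar>"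
    using h by (simp add: s_form_def h_def mult.assoc abs_mult flip: right_diff_distrib)
  also have "\<dots> \<le> h * ((r + 4) * ((?N w powr r + ?N z powr r) powr ((r - q) / r)
      * (?N e powr r) powr ((q - 1) / r) * (?N v powr r) powr (1 / r)))"
    unfolding e by (intro mult_left_mono flux_difference_L2_set r q h)
  also have "\<dots> = (h powr ((r - q) / r) * h powr ((q - 1) / r) * h powr (1 / r))
      * ((r + 4) * ((?N w powr r + ?N z powr r) powr ((r - q) / r)
      * (?N e powr r) powr ((q - 1) / r) * (?N v powr r) powr (1 / r)))"
    by (simp only: hp)
  also have "\<dots> = (r + 4) * (h * (?N w powr r + ?N z powr r)) powr ((r - q) / r)
      * (h * ?N e powr r) powr ((q - 1) / r) * (h * ?N v powr r) powr (1 / r)"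
    using h by (simp only: powr_mult powr_ge_zero add_nonneg_nonneg) (simp only: mult_ac)
  also have "\<dots> = (r + 4) * (s_form r k n P w w + s_form r k n P z z) powr ((r - q) / r)
      * s_form r k n P e e powr ((q - 1) / r) * s_form r k n P v v powr (1 / r)"
    by (simp only: s_form_self[OF r] h_def distrib_left)
  finally show ?thesis .
qed

theorem lemma24:
  fixes p p' q :: real
  assumes "1 < p" and "p' = p / (p - 1)" and "q = min p' 2"
  shows "\<exists>C>0. \<forall>(k :: nat) (\<Omega> :: point set) (\<rho> :: real) (\<T> :: polygon set set).
    polygonal_domain \<Omega> \<and> \<rho> > 0 \<and> (\<forall>T\<in>\<T>. decomposition \<Omega> T \<and> mesh_regular \<rho> T) \<longrightarrow>
    (\<forall>T\<in>\<T>. \<forall>n. unit_normals T n \<longrightarrow>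
      (\<forall>E\<in>T. \<forall>v\<in>V_h k n E. \<forall>w\<in>V_h k n E. \<forall>z\<in>V_h k n E.
        let e = (\<lambda>x. w x - z x) in
          ennreal \<bar>a_form p' E w v - a_form p' E z v\<bar>
            \<le> ennreal C
              * epowr (epowr (L_norm p' E w) p' + epowr (L_norm p' E z) p') ((p' - q) / p')
              * epowr (L_norm p' E e) (q - 1)
              * L_norm p' E v
        \<and> \<bar>s_form p' k n E w v - s_form p' k n E z v\<bar>
            \<le> C
              * (s_form p' k n E w w + s_form p' k n E z z) powr ((p' - q) / p')
              * s_form p' k n E e e powr ((q - 1) / p')
              * s_form p' k n E v v powr (1 / p')))"
\<comment> \<open>The constant of the flux inequality serves both estimates. It is fixed before the
  degree, domain, meshes, normals and element, so it depends on \<open>p\<close> alone.\<close>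
proof (rule exI[of _ "p' + 4"], intro conjI allI impI ballI, goal_cases)
  have r: "1 < p'" using assms by simp
  case 1
  then show ?case using r by simp
next
  have r: "1 < p'" using assms by simp
  case (2 k \<Omega> \<rho> \<T> T n E v w z)
  \<comment> \<open>Simplicity of the element and the properties of the normals enter through the
    uniqueness of normal traces behind \<open>dof_diff\<close>.\<close>
  have P: "simple_polygon E" using 2 by (auto simp: decomposition_def)
  have n: "norm (n (edge E i)) = 1" "n (edge E i) \<bullet> (vtx E (Suc i) - vtx E i) = 0"
    if "i < length E" for i
    using 2 that by (auto simp: unit_normals_def)
  have L2: "L2_on (region E) v" "L2_on (region E) w" "L2_on (region E) z"
    using 2 by (auto simp: V_h_def H_div_def)
  have wz: "w \<in> V_h k n E" "z \<in> V_h k n E" using 2 by auto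
  show ?case
    unfolding Let_def
    by (intro conjI a_form_difference[OF r assms(3) L2] s_form_difference[OF r assms(3)]
        dof_diff[OF P n wz])
qed

end
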